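(* Let $n\ge4$ be fixed and $p,q\to\infty$. Assume: (i) There are constants $0<a\le A<\infty$, $0<a'\le A'<\infty$ and $0<a''\le A''<\infty$ such that, uniformly over $p$ and $q$, $a\le E\rho^X_i(X_{(i)},X'_{(i)})\le A$ for all $1\le i\le p$, $a'\le E\rho^Y_j(Y_{(j)},Y'_{(j)})\le A'$ for all $1\le j\le q$, and $a''\le E\rho_i(X_{(i)},Y_{(i)})\le A''$ for all those $i$ for which this expression is defined (i.e. $i\le\min(p,q)$, $d_i=g_i$ and $\rho^X_i=\rho^Y_i=:\rho_i$). (ii) $L(X,X')=O_p(a_p)$ and $L(Y,Y')=O_p(b_q)$, where $a_p,b_q$ are positive real sequences with $a_p=o(1)$, $b_q=o(1)$, $\tau_{XY}\,a_p^2b_q=o(1)$ and $\tau_{XY}\,a_pb_q^2=o(1)$. Then $$\widetilde{\mathcal D^2_n}(X,Y)=\frac1{4\tau_{XY}}\sum_{i=1}^p\sum_{j=1}^q\widetilde{D^2_n}_{;\rho^X_i,\rho^Y_j}(X_{(i)},Y_{(j)})+\mathcal R_n,$$ where $\mathcal R_n$ is the remainder term. Moreover $\mathcal R_n=O_p(\tau_{XY}\,a_p^2b_q+\tau_{XY}\,a_pb_q^2)=o_p(1)$, i.e., $\mathcal R_n$ is of smaller order compared to the leading term (the first term on the right-hand side) and hence is asymptotically negligible.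
   Context: $X=(X_{(1)},\dots,X_{(p)})\in\mathbb R^{\tilde p}$ and $Y=(Y_{(1)},\dots,Y_{(q)})\in\mathbb R^{\tilde q}$ are (possibly dependent) random vectors, with groups $X_{(i)}\in\mathbb R^{d_i}$, $Y_{(j)}\in\mathbb R^{g_j}$, $\tilde p=\sum d_i$, $\tilde q=\sum g_j$, and $d_i,g_j$ bounded. $(X',Y')$ is an independent copy of $(X,Y)$, and $(X_k,Y_k)_{k=1}^n$ are i.i.d. copies of $(X,Y)$ with groups $X_{k(i)},Y_{k(j)}$. Distances: $K(x,x')=\sqrt{\sum_{i=1}^p\rho^X_i(x_{(i)},x'_{(i)})}$ on $\mathbb R^{\tilde p}$ and $K(y,y')=\sqrt{\sum_{j=1}^q\rho^Y_j(y_{(j)},y'_{(j)})}$ on $\mathbb R^{\tilde q}$ (same letter $K$), where each distance falls in Case S1 (every $\rho_i$ is a metric of strong negative type on its Euclidean space) or Case S2 (every $\rho_i$ is the squared Euclidean distance). A metric space $(\mathcal X,d)$ has negative type if for all $N\ge1$, $x_1,\dots,x_N\in\mathcal X$ and $\alpha_1,\dots,\alpha_N\in\mathbb R$ with $\sum_i\alpha_i=0$ one has $\sum_{i,j}\alpha_i\alpha_jd(x_i,x_j)\le0$; it has strong negative type if moreover (for distinct points $x_1,\dots,x_N$) equality holds only when $\alpha_i=0$ for all $i$. $\mathcal U$-centering: for $A=(a_{kl})\in\mathbb R^{n\times n}$, $\tilde a_{kl}=a_{kl}-\frac1{n-2}\sum_ja_{kj}-\frac1{n-2}\sum_ia_{il}+\frac1{(n-1)(n-2)}\sum_{i,j}a_{ij}$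 for $k\ne l$, $\tilde a_{kk}=0$. For functions $\rho,\rho'$ and a sample $(U_k,V_k)_{k=1}^n$ of $(U,V)$, $\widetilde{D^2_n}_{;\rho,\rho'}(U,V)=\frac1{n(n-3)}\sum_{k\ne l}\tilde a_{kl}\tilde b_{kl}$ with $a_{kl}=\rho(U_k,U_l)$, $b_{kl}=\rho'(V_k,V_l)$. $\widetilde{\mathcal D^2_n}(X,Y)$ is this quantity for the sample $(X_k,Y_k)$ with $\rho=K$ on $\mathbb R^{\tilde p}$, $\rho'=K$ on $\mathbb R^{\tilde q}$; $\widetilde{D^2_n}_{;\rho^X_i,\rho^Y_j}(X_{(i)},Y_{(j)})$ uses the sample $(X_{k(i)},Y_{k(j)})_{k=1}^n$. $\tau_X^2=EK^2(X,X')$, $\tau_Y^2=EK^2(Y,Y')$, $\tau_{XY}=\tau_X\tau_Y$; $L(X,X')=\frac{K^2(X,X')-\tau_X^2}{\tau_X^2}$, $L(Y,Y')=\frac{K^2(Y,Y')-\tau_Y^2}{\tau_Y^2}$. *)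

theory Defs
  imports "HOL-Probability.Probability" "HOL-Library.Landau_Symbols"
begin

section \<open>Group spaces and distances\<close>

text \<open>The dimensions of the groups vary with the group index, so \<open>\<real>\<^sup>d\<close> with its Borel sets is
  the finite product measure space on \<open>{..<d}\<close>. Its points are the extensional functions, so
  equality of points is equality of the \<open>d\<close> coordinates.\<close>

definition euclid :: "nat \<Rightarrow> (nat \<Rightarrow> real) measure" where
  "euclid d = Pi\<^sub>M {..<d} (\<lambda>_. borel)"

text \<open>A vector in \<open>\<real>\<close> to the power \<open>d 1 + \<dots> + d p\<close> is represented by its groups \<open>x 1, \<dots>, x p\<close>.\<close>

definition grouped :: "nat \<Rightarrow> (nat \<Rightarrow> nat) \<Rightarrow> (nat \<Rightarrow> nat \<Rightarrow> real) measure" where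
  "grouped p d = Pi\<^sub>M {1..p} (\<lambda>i. euclid (d i))"

definition negative_type :: "'a set \<Rightarrow> ('a \<Rightarrow> 'a \<Rightarrow> real) \<Rightarrow> bool" where
  "negative_type S \<rho> \<longleftrightarrow>
     (\<forall>N\<ge>1. \<forall>(x :: nat \<Rightarrow> 'a) (\<alpha> :: nat \<Rightarrow> real).
        x \<in> {1..N} \<rightarrow> S \<longrightarrow> (\<Sum>i=1..N. \<alpha> i) = 0 \<longrightarrow>
        (\<Sum>i=1..N. \<Sum>j=1..N. \<alpha> i * \<alpha> j * \<rho> (x i) (x j)) \<le> 0)"

definition strong_negative_type :: "'a set \<Rightarrow> ('a \<Rightarrow> 'a \<Rightarrow> real) \<Rightarrow> bool" where
  "strong_negative_type S \<rho> \<longleftrightarrow>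
     negative_type S \<rho> \<and>
     (\<forall>N\<ge>1. \<forall>(x :: nat \<Rightarrow> 'a) (\<alpha> :: nat \<Rightarrow> real).
        x \<in> {1..N} \<rightarrow> S \<longrightarrow> inj_on x {1..N} \<longrightarrow> (\<Sum>i=1..N. \<alpha> i) = 0 \<longrightarrow>
        (\<Sum>i=1..N. \<Sum>j=1..N. \<alpha> i * \<alpha> j * \<rho> (x i) (x j)) = 0 \<longrightarrow>
        (\<forall>i\<in>{1..N}. \<alpha> i = 0))"

definition case_S1 :: "nat \<Rightarrow> (nat \<Rightarrow> nat) \<Rightarrow> (nat \<Rightarrow> (nat \<Rightarrow> real) \<Rightarrow> (nat \<Rightarrow> real) \<Rightarrow> real) \<Rightarrow> bool" where
  "case_S1 p d \<rho> \<longleftrightarrow>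
     (\<forall>i\<in>{1..p}. Metric_space (space (euclid (d i))) (\<rho> i) \<and>
                 strong_negative_type (space (euclid (d i))) (\<rho> i))"

definition case_S2 :: "nat \<Rightarrow> (nat \<Rightarrow> nat) \<Rightarrow> (nat \<Rightarrow> (nat \<Rightarrow> real) \<Rightarrow> (nat \<Rightarrow> real) \<Rightarrow> real) \<Rightarrow> bool" where
  "case_S2 p d \<rho> \<longleftrightarrow>
     (\<forall>i\<in>{1..p}. \<forall>u\<in>space (euclid (d i)). \<forall>v\<in>space (euclid (d i)).
        \<rho> i u v = (\<Sum>c<d i. (u c - v c)\<^sup>2))"

definition K :: "nat \<Rightarrow> (nat \<Rightarrow> (nat \<Rightarrow> real) \<Rightarrow> (nat \<Rightarrow> real) \<Rightarrow> real)
    \<Rightarrow> (nat \<Rightarrow> nat \<Rightarrow> real) \<Rightarrow> (nat \<Rightarrow> nat \<Rightarrow> real) \<Rightarrow> real" where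
  "K p \<rho> x x' = sqrt (\<Sum>i=1..p. \<rho> i (x i) (x' i))"


section \<open>The U-centered statistic\<close>

definition U_center :: "nat \<Rightarrow> (nat \<Rightarrow> nat \<Rightarrow> real) \<Rightarrow> nat \<Rightarrow> nat \<Rightarrow> real" where
  "U_center n a k l =
     (if k = l then 0
      else a k l
         - 1 / (real n - 2) * (\<Sum>j=1..n. a k j)
         - 1 / (real n - 2) * (\<Sum>i=1..n. a i l)
         + 1 / ((real n - 1) * (real n - 2)) * (\<Sum>i=1..n. \<Sum>j=1..n. a i j))"

definition D2 :: "nat \<Rightarrow> ('u \<Rightarrow> 'u \<Rightarrow> real) \<Rightarrow> ('v \<Rightarrow> 'v \<Rightarrow> real)
    \<Rightarrow> (nat \<Rightarrow> 'u) \<Rightarrow> (nat \<Rightarrow> 'v) \<Rightarrow> real" where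
  "D2 n \<rho> \<rho>' U V =
     1 / (real n * (real n - 3)) *
     (\<Sum>k=1..n. \<Sum>l\<in>{1..n} - {k}.
        U_center n (\<lambda>k l. \<rho> (U k) (U l)) k l * U_center n (\<lambda>k l. \<rho>' (V k) (V l)) k l)"


section \<open>Copies, normalisation and stochastic order\<close>

definition indep_copy :: "'w measure \<Rightarrow> 'z measure \<Rightarrow> ('w \<Rightarrow> 'z) \<Rightarrow> ('w \<Rightarrow> 'z) \<Rightarrow> bool" where
  "indep_copy M S Z Z' \<longleftrightarrow>
     prob_space.indep_var M S Z S Z' \<and> distr M S Z' = distr M S Z"

definition iid_copies :: "'w measure \<Rightarrow> 'z measure \<Rightarrow> nat \<Rightarrow> ('w \<Rightarrow> 'z) \<Rightarrow> (nat \<Rightarrow> 'w \<Rightarrow> 'z) \<Rightarrow> bool" where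
  "iid_copies M S n Z Zs \<longleftrightarrow>
     prob_space.indep_vars M (\<lambda>_. S) Zs {1..n} \<and> (\<forall>k\<in>{1..n}. distr M S (Zs k) = distr M S Z)"

definition tau :: "'w measure \<Rightarrow> ('u \<Rightarrow> 'u \<Rightarrow> real) \<Rightarrow> ('w \<Rightarrow> 'u) \<Rightarrow> ('w \<Rightarrow> 'u) \<Rightarrow> real" where
  "tau M \<kappa> U U' = sqrt (\<integral>\<omega>. (\<kappa> (U \<omega>) (U' \<omega>))\<^sup>2 \<partial>M)"

definition L_dev :: "'w measure \<Rightarrow> ('u \<Rightarrow> 'u \<Rightarrow> real) \<Rightarrow> ('w \<Rightarrow> 'u) \<Rightarrow> ('w \<Rightarrow> 'u) \<Rightarrow> 'w \<Rightarrow> real" where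
  "L_dev M \<kappa> U U' \<omega> =
     ((\<kappa> (U \<omega>) (U' \<omega>))\<^sup>2 - (tau M \<kappa> U U')\<^sup>2) / (tau M \<kappa> U U')\<^sup>2"

text \<open>\<open>O\<^sub>p\<close> and \<open>o\<^sub>p\<close> along a filter, for variables \<open>Z s\<close> that live on different probability
  spaces \<open>M s\<close>. They are meant for measurable \<open>Z s\<close>, since \<open>measure\<close> is \<open>0\<close> on sets that are not
  measurable.\<close>

definition bigO_prob :: "'s filter \<Rightarrow> ('s \<Rightarrow> 'w measure) \<Rightarrow> ('s \<Rightarrow> 'w \<Rightarrow> real) \<Rightarrow> ('s \<Rightarrow> real) \<Rightarrow> bool" where
  "bigO_prob F M Z r \<longleftrightarrow>
     (\<forall>\<epsilon>>0. \<exists>C>0. \<forall>\<^sub>F s in F.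
        measure (M s) {\<omega> \<in> space (M s). \<bar>Z s \<omega>\<bar> > C * \<bar>r s\<bar>} \<le> \<epsilon>)"

definition smallo_prob :: "'s filter \<Rightarrow> ('s \<Rightarrow> 'w measure) \<Rightarrow> ('s \<Rightarrow> 'w \<Rightarrow> real) \<Rightarrow> ('s \<Rightarrow> real) \<Rightarrow> bool" where
  "smallo_prob F M Z r \<longleftrightarrow>
     (\<forall>\<epsilon>>0. ((\<lambda>s. measure (M s) {\<omega> \<in> space (M s). \<bar>Z s \<omega>\<bar> > \<epsilon> * \<bar>r s\<bar>}) \<longlongrightarrow> 0) F)"

text \<open>Sequences indexed by \<open>(p, q)\<close> are considered as \<open>p\<close> and \<open>q\<close> both tend to infinity, with no
  relation between their rates.\<close>

abbreviation pq_infty :: "(nat \<times> nat) filter" where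
  "pq_infty \<equiv> at_top \<times>\<^sub>F at_top"

end

theory Submission
  imports Defs
begin

text \<open>Write \<open>K = \<tau> * sqrt (1 + L)\<close> off the diagonal and expand \<open>sqrt (1 + L) = 1 + L / 2 + r\<close> with
  \<open>\<bar>r\<bar> \<le> L\<^sup>2 / 2\<close>. U-centering annihilates the matrix with constant off-diagonal entries and zero
  diagonal, so the centered \<open>K\<close> is \<open>\<tau>\<close> times the centered \<open>L / 2 + r\<close>, while the centered
  \<open>K\<^sup>2 = (\<Sum>i. \<rho>\<^sub>i)\<close> is \<open>\<tau>\<^sup>2\<close> times the centered \<open>L\<close>. By bilinearity the leading term is the
  contribution of the two linear parts, and the remainder collects the products that contain at
  least one \<open>r\<close>. The \<open>n * (n - 1)\<close> pairs of sample points all have the law of a point and its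
  independent copy, so a union bound makes all \<open>L\<close> of order \<open>a\<^sub>p\<close> (or \<open>b\<^sub>q\<close>) simultaneously.\<close>

section \<open>U-centering\<close>

text \<open>With \<open>s = sqrt (1 + x)\<close> the error is exactly
  \<open>- (s - 1)\<^sup>2 / 2\<close>, and \<open>\<bar>s - 1\<bar> \<le> \<bar>s - 1\<bar> * (s +
  1) = \<bar>x\<bar>\<close>. No smallness of \<open>x\<close> enters, so the expansion applies to
  every deviation \<open>L\<close>, not only near zero.\<close>

lemma sqrt_taylor_bound:
  fixes x :: real
  assumes "-1 \<le> x"
  shows "\<bar>sqrt (1 + x) - 1 - x / 2\<bar> \<le> x\<^sup>2 / 2"
proof -
  define s where "s = sqrt (1 + x)"
  have s: "s \<ge> 0" "s\<^sup>2 = 1 + x" using assms by (auto simp: s_def)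
  have "\<bar>s - 1\<bar> * 1 \<le> \<bar>s - 1\<bar> * (s + 1)" using s by (intro mult_left_mono) auto
  also have "\<dots> = \<bar>(s - 1) * (s + 1)\<bar>" using s by (simp add: abs_mult)
  also have "(s - 1) * (s + 1) = x" using s by (simp add: algebra_simps power2_eq_square)
  finally have "(s - 1)\<^sup>2 \<le> x\<^sup>2" by (simp add: abs_le_square_iff)
  moreover have "s - 1 - x / 2 = - ((s - 1)\<^sup>2 / 2)"
    using s(2) by (simp add: power2_diff field_simps)
  ultimately show ?thesis unfolding s_def by simp
qed

text \<open>The decompositions of the distance matrix hold only at sample indices; this lets them be
  substituted under the centering.\<close>

lemma U_center_cong:
  assumes "\<And>k l. k \<in> {1..n} \<Longrightarrow> l \<in> {1..n} \<Longrightarrow> a k l = b k l" "k \<in> {1..n}" "l \<in> {1..n}"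
  shows "U_center n a k l = U_center n b k l"
proof -
  have "(\<Sum>j=1..n. a i j) = (\<Sum>j=1..n. b i j)" if "i \<in> {1..n}" for i
    using assms(1) that by (intro sum.cong) auto
  moreover have "(\<Sum>i=1..n. a i l) = (\<Sum>i=1..n. b i l)"
    using assms by (intro sum.cong) auto
  moreover have "(\<Sum>i=1..n. \<Sum>j=1..n. a i j) = (\<Sum>i=1..n. \<Sum>j=1..n. b i j)"
    using assms(1) by (intro sum.cong) auto
  ultimately show ?thesis using assms by (simp only: U_center_def)
qed

lemma U_center_add:
  "U_center n (\<lambda>k l. a k l + b k l) k l = U_center n a k l + U_center n b k l"
  by (simp add: U_center_def sum.distrib algebra_simps)

lemma U_center_cmult: "U_center n (\<lambda>k l. c * a k l) k l = c * U_center n a k l"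
  by (simp add: U_center_def sum_distrib_left[symmetric] algebra_simps)

lemma U_center_sum:
  "U_center n (\<lambda>k l. \<Sum>i\<in>I. a i k l) k l = (\<Sum>i\<in>I. U_center n (a i) k l)"
proof (induction I rule: infinite_finite_induct)
  case (insert i I)
  then show ?case by (simp add: U_center_add)
qed (simp_all add: U_center_def)

text \<open>Rows and columns sum to \<open>(n - 1) * c\<close> and the whole matrix to
  \<open>n * (n - 1) * c\<close>, so the numerator over \<open>n - 2\<close> is
  \<open>c * ((n - 2) - 2 * (n - 1) + n) = 0\<close>. The zero diagonal matters: a matrix constant
  everywhere would be sent to \<open>- c / (n - 1)\<close> off the diagonal.\<close>

lemma U_center_const_offdiag:
  assumes "n \<ge> 3" "k \<in> {1..n}" "l \<in> {1..n}"
  shows "U_center n (\<lambda>k l. if k = l then 0 else c) k l = 0"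
proof -
  have row: "(\<Sum>j=1..n. if i = j then 0 else c) = (real n - 1) * c" if "i \<in> {1..n}" for i
  proof -
    have "(\<Sum>j=1..n. if i = j then 0 else c) = (\<Sum>j\<in>{1..n} - {i}. c)"
      by (rule sum.mono_neutral_cong_right) auto
    then show ?thesis using that by (simp add: of_nat_diff)
  qed
  have col: "(\<Sum>i=1..n. if i = j then 0 else c) = (real n - 1) * c" if "j \<in> {1..n}" for j
    using row[OF that] by (simp only: eq_commute[of _ j])
  have tot: "(\<Sum>i=1..n. \<Sum>j=1..n. if i = j then 0 else c) = real n * ((real n - 1) * c)"
    using row by simp
  have n: "real n \<ge> 3" using assms by linarith
  then have "1 / ((real n - 1) * (real n - 2)) * (real n * ((real n - 1) * c)) = real n * c / (real n - 2)"
    by simp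
  moreover have "c - 1 / (real n - 2) * ((real n - 1) * c) - 1 / (real n - 2) * ((real n - 1) * c)
      + real n * c / (real n - 2) = (c * (real n - 2) - 2 * ((real n - 1) * c) + real n * c) / (real n - 2)"
    using n by (simp add: add_divide_distrib diff_divide_distrib)
  moreover have "c * (real n - 2) - 2 * ((real n - 1) * c) + real n * c = 0"
    by (simp add: algebra_simps)
  ultimately show ?thesis
    unfolding U_center_def tot row[OF assms(2)] col[OF assms(3)] by simp
qed

text \<open>The constant is \<open>9 = 1 + 2 + 2 + 4\<close>, for the entry, its row, its column and
  the total: for \<open>n \<ge> 4\<close> the quotients \<open>n / (n - 2)\<close> and
  \<open>n\<^sup>2 / ((n - 1) * (n - 2))\<close> are at most 2 and 4.\<close>

lemma U_center_bound:
  assumes "n \<ge> 4" and a: "\<And>k l. k \<in> {1..n} \<Longrightarrow> l \<in> {1..n} \<Longrightarrow> \<bar>a k l\<bar> \<le> m"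
    and "k \<in> {1..n}" "l \<in> {1..n}"
  shows "\<bar>U_center n a k l\<bar> \<le> 9 * m"
proof -
  have m: "0 \<le> m" using a[OF assms(3,4)] by linarith
  have n: "real n \<ge> 4" using assms(1) by linarith
  have sum_le: "\<bar>\<Sum>j=1..n. f j\<bar> \<le> real n * e"
    if "\<And>j. j \<in> {1..n} \<Longrightarrow> \<bar>f j\<bar> \<le> e" for f :: "nat \<Rightarrow> real" and e
    using order_trans[OF sum_abs sum_bounded_above, of "{1..n}" f e] that by simp
  have row: "\<bar>\<Sum>j=1..n. a k j\<bar> \<le> real n * m"
    by (rule sum_le) (rule a[OF assms(3)])
  have col: "\<bar>\<Sum>i=1..n. a i l\<bar> \<le> real n * m"
    by (rule sum_le) (rule a[OF _ assms(4)])
  have tot: "\<bar>\<Sum>i=1..n. \<Sum>j=1..n. a i j\<bar> \<le> real n * (real n * m)"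
    using assms by (intro sum_le) auto
  have scale: "\<bar>c * x\<bar> \<le> t * m" if "\<bar>x\<bar> \<le> y * m" "0 \<le> c" "c * y \<le> t" for c x y t
  proof -
    have "\<bar>c * x\<bar> \<le> c * (y * m)" using that by (simp add: abs_mult mult_left_mono)
    also have "\<dots> = c * y * m" by simp
    also have "\<dots> \<le> t * m" using that m by (intro mult_right_mono)
    finally show ?thesis .
  qed
  have n1: "1 / (real n - 2) * real n \<le> 2" using n by (simp add: field_simps)
  \<comment> \<open>The right side exceeds the left by \<open>3 * (n - 4) * n + 8\<close>.\<close>
  have "real n * real n \<le> 4 * ((real n - 1) * (real n - 2))"
  proof -
    have "0 \<le> 3 * (real n - 4) * real n" using n by simp
    then show ?thesis by (simp add: algebra_simps)
  qed
  then have n2: "1 / ((real n - 1) * (real n - 2)) * (real n * real n) \<le> 4"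
    using n by (simp add: divide_le_eq)
  have r: "\<bar>1 / (real n - 2) * (\<Sum>j=1..n. a k j)\<bar> \<le> 2 * m"
    and c: "\<bar>1 / (real n - 2) * (\<Sum>i=1..n. a i l)\<bar> \<le> 2 * m"
    by (rule scale[OF row] scale[OF col]; use n n1 in simp)+
  have t: "\<bar>1 / ((real n - 1) * (real n - 2)) * (\<Sum>i=1..n. \<Sum>j=1..n. a i j)\<bar> \<le> 4 * m"
    using n n2 tot by (intro scale[of _ "real n * real n"]) (auto simp: mult.assoc)
  have "\<bar>w - x - y + z\<bar> \<le> 9 * m"
    if "\<bar>w\<bar> \<le> m" "\<bar>x\<bar> \<le> 2 * m" "\<bar>y\<bar> \<le> 2 * m" "\<bar>z\<bar> \<le> 4 * m" for w x y z
    using that by linarith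
  note bound = this[OF a[OF assms(3,4)] r c t]
  show ?thesis
  proof (cases "k = l")
    case True
    then show ?thesis using m by (simp add: U_center_def)
  next
    case False
    show ?thesis unfolding U_center_def if_not_P[OF False] by (rule bound)
  qed
qed

text \<open>The deviation is only controlled off the diagonal: on it \<open>A k k = 0\<close> deviates by \<open>-1\<close>.\<close>

lemma U_center_expansion:
  fixes A :: "nat \<Rightarrow> nat \<Rightarrow> real"
  assumes n: "n \<ge> 4" and \<tau>: "\<tau> > 0"
    and diag: "\<And>k. k \<in> {1..n} \<Longrightarrow> A k k = 0"
    and nonneg: "\<And>k l. k \<in> {1..n} \<Longrightarrow> l \<in> {1..n} \<Longrightarrow> A k l \<ge> 0"
    and dev: "\<And>k l. k \<in> {1..n} \<Longrightarrow> l \<in> {1..n} \<Longrightarrow> k \<noteq> l \<Longrightarrow> \<bar>(A k l - \<tau>\<^sup>2) / \<tau>\<^sup>2\<bar> \<le> \<alpha>"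
    and \<alpha>: "\<alpha> \<ge> 0" and kl: "k \<in> {1..n}" "l \<in> {1..n}"
  obtains u r where "U_center n A k l = \<tau>\<^sup>2 * u"
    and "U_center n (\<lambda>k l. sqrt (A k l)) k l = \<tau> * (u / 2 + r)"
    and "\<bar>u\<bar> \<le> 9 * \<alpha>" "\<bar>r\<bar> \<le> 9 * (\<alpha>\<^sup>2 / 2)"
proof -
  \<comment> \<open>Zeros on the diagonals of \<open>L\<close> and \<open>r\<close> let the zero
    diagonal of \<open>A\<close> be carried by the constant part, which centering annihilates, and
    make the bounds on \<open>L\<close> and \<open>r\<close> hold at every entry.\<close>
  define L where "L k l = (if k = l then 0 else (A k l - \<tau>\<^sup>2) / \<tau>\<^sup>2)" for k l
  define r where "r k l = (if k = l then 0 else sqrt (1 + L k l) - 1 - L k l / 2)" for k l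
  have A: "A k l = (if k = l then 0 else \<tau>\<^sup>2) + \<tau>\<^sup>2 * L k l"
    if "k \<in> {1..n}" "l \<in> {1..n}" for k l
    using \<tau> diag that by (auto simp: L_def field_simps)
  have sqA: "sqrt (A k l) = (if k = l then 0 else \<tau>) + (\<tau> / 2 * L k l + \<tau> * r k l)"
    if "k \<in> {1..n}" "l \<in> {1..n}" for k l
  proof (cases "k = l")
    case True
    then show ?thesis using diag that by (simp add: L_def r_def)
  next
    case False
    then have "A k l = \<tau>\<^sup>2 * (1 + L k l)" using A[OF that] by (simp add: algebra_simps)
    then have "sqrt (A k l) = \<tau> * sqrt (1 + L k l)" using \<tau> by (simp add: real_sqrt_mult)
    then show ?thesis using False by (simp add: r_def algebra_simps)
  qed
  have L: "\<bar>L k l\<bar> \<le> \<alpha>" if "k \<in> {1..n}" "l \<in> {1..n}" for k l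
    using dev[OF that] \<alpha> by (simp add: L_def)
  have r: "\<bar>r k l\<bar> \<le> \<alpha>\<^sup>2 / 2" if "k \<in> {1..n}" "l \<in> {1..n}" for k l
  proof (cases "k = l")
    case True
    then show ?thesis by (simp add: r_def)
  next
    case False
    have "-1 \<le> L k l" using nonneg[OF that] \<tau> False by (simp add: L_def field_simps)
    moreover have "(L k l)\<^sup>2 \<le> \<alpha>\<^sup>2" using L[OF that] by (simp add: abs_le_square_iff[symmetric])
    ultimately show ?thesis using sqrt_taylor_bound[of "L k l"] False by (simp add: r_def)
  qed
  show thesis
  proof
    show "U_center n A k l = \<tau>\<^sup>2 * U_center n L k l"
      using U_center_cong[OF A kl] n kl
      by (simp add: U_center_add U_center_cmult U_center_const_offdiag)
    show "U_center n (\<lambda>k l. sqrt (A k l)) k l = \<tau> * (U_center n L k l / 2 + U_center n r k l)"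
      using U_center_cong[OF sqA kl] n kl
      by (simp only: U_center_add U_center_cmult U_center_const_offdiag) (simp add: algebra_simps)
    show "\<bar>U_center n L k l\<bar> \<le> 9 * \<alpha>" by (rule U_center_bound[OF n L kl])
    show "\<bar>U_center n r k l\<bar> \<le> 9 * (\<alpha>\<^sup>2 / 2)" by (rule U_center_bound[OF n r kl])
  qed
qed

section \<open>Averages of products of centered matrices\<close>

text \<open>There are at most \<open>n\<^sup>2\<close> terms against the weight
  \<open>1 / (n * (n - 3))\<close>, and \<open>n / (n - 3) \<le> 4\<close> for
  \<open>n \<ge> 4\<close>, with equality at \<open>n = 4\<close>.\<close>

lemma U_average_bound:
  fixes f :: "nat \<Rightarrow> nat \<Rightarrow> real"
  assumes n: "n \<ge> 4" and f: "\<And>k l. k \<in> {1..n} \<Longrightarrow> l \<in> {1..n} \<Longrightarrow> \<bar>f k l\<bar> \<le> m"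
  shows "\<bar>1 / (real n * (real n - 3)) * (\<Sum>k=1..n. \<Sum>l\<in>{1..n} - {k}. f k l)\<bar> \<le> 4 * m"
proof -
  have m: "0 \<le> m" using f[of 1 1] n by force
  have rn: "real n \<ge> 4" using n by linarith
  have row: "\<bar>\<Sum>l\<in>{1..n} - {k}. f k l\<bar> \<le> real n * m" if "k \<in> {1..n}" for k
  proof -
    have "\<bar>\<Sum>l\<in>{1..n} - {k}. f k l\<bar> \<le> (\<Sum>l\<in>{1..n} - {k}. \<bar>f k l\<bar>)" by (rule sum_abs)
    also have "\<dots> \<le> (\<Sum>l=1..n. \<bar>f k l\<bar>)" by (intro sum_mono2) auto
    also have "\<dots> \<le> real n * m"
      using sum_bounded_above[of "{1..n}" "\<lambda>l. \<bar>f k l\<bar>" m] f[OF that] by simp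
    finally show ?thesis .
  qed
  have "\<bar>\<Sum>k=1..n. \<Sum>l\<in>{1..n} - {k}. f k l\<bar> \<le> (\<Sum>k=1..n. \<bar>\<Sum>l\<in>{1..n} - {k}. f k l\<bar>)"
    by (rule sum_abs)
  also have "\<dots> \<le> real n * (real n * m)"
    using sum_bounded_above[of "{1..n}" "\<lambda>k. \<bar>\<Sum>l\<in>{1..n} - {k}. f k l\<bar>" "real n * m"] row by simp
  finally have "\<bar>1 / (real n * (real n - 3)) * (\<Sum>k=1..n. \<Sum>l\<in>{1..n} - {k}. f k l)\<bar>
      \<le> 1 / (real n * (real n - 3)) * (real n * (real n * m))"
    using rn unfolding abs_mult by (intro mult_mono) auto
  also have "\<dots> = real n / (real n - 3) * m" using rn by simp
  also have "\<dots> \<le> 4 * m" using rn m by (intro mult_right_mono) (simp_all add: field_simps)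
  finally show ?thesis .
qed

text \<open>Entrywise, the centered roots are \<open>\<tau> * (u / 2 + r)\<close> and
  \<open>\<sigma> * (v / 2 + s)\<close>, the centered matrices \<open>\<tau>\<^sup>2 * u\<close> and
  \<open>\<sigma>\<^sup>2 * v\<close>. The scaled product of the latter is
  \<open>\<tau> * \<sigma> * (u * v / 4)\<close>, precisely the \<open>u * v\<close> part of the
  product of the roots, so what is left is
  \<open>\<tau> * \<sigma> * (u * s / 2 + r * v / 2 + r * s)\<close>. Each summand contributes a
  constant \<open>9 * 9 / 4\<close>, and averaging multiplies it by 4, whence 81.\<close>

lemma U_product_expansion:
  fixes A A' :: "nat \<Rightarrow> nat \<Rightarrow> real" and n :: nat
  defines "sprod a b \<equiv> 1 / (real n * (real n - 3)) *
      (\<Sum>k=1..n. \<Sum>l\<in>{1..n} - {k}. U_center n a k l * U_center n b k l)"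
  assumes n: "n \<ge> 4" and pos: "\<tau> > 0" "\<sigma> > 0" "\<alpha> \<ge> 0" "\<beta> \<ge> 0"
    and A: "\<And>k. k \<in> {1..n} \<Longrightarrow> A k k = 0"
      "\<And>k l. k \<in> {1..n} \<Longrightarrow> l \<in> {1..n} \<Longrightarrow> A k l \<ge> 0"
      "\<And>k l. k \<in> {1..n} \<Longrightarrow> l \<in> {1..n} \<Longrightarrow> k \<noteq> l \<Longrightarrow> \<bar>(A k l - \<tau>\<^sup>2) / \<tau>\<^sup>2\<bar> \<le> \<alpha>"
    and A': "\<And>k. k \<in> {1..n} \<Longrightarrow> A' k k = 0"
      "\<And>k l. k \<in> {1..n} \<Longrightarrow> l \<in> {1..n} \<Longrightarrow> A' k l \<ge> 0"
      "\<And>k l. k \<in> {1..n} \<Longrightarrow> l \<in> {1..n} \<Longrightarrow> k \<noteq> l \<Longrightarrow> \<bar>(A' k l - \<sigma>\<^sup>2) / \<sigma>\<^sup>2\<bar> \<le> \<beta>"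
  shows "\<bar>1 / (4 * (\<tau> * \<sigma>)) * sprod A A'\<bar> \<le> 81 * (\<tau> * \<sigma> * \<alpha> * \<beta>)" (is ?lead)
    and "\<bar>sprod (\<lambda>k l. sqrt (A k l)) (\<lambda>k l. sqrt (A' k l)) - 1 / (4 * (\<tau> * \<sigma>)) * sprod A A'\<bar>
      \<le> 81 * (\<tau> * \<sigma> * (\<alpha> * \<beta>\<^sup>2 + \<alpha>\<^sup>2 * \<beta> + \<alpha>\<^sup>2 * \<beta>\<^sup>2))" (is ?rem)
proof -
  let ?c = "1 / (real n * (real n - 3))"
  have scale: "1 / (4 * (\<tau> * \<sigma>)) * sprod A A' = ?c *
      (\<Sum>k=1..n. \<Sum>l\<in>{1..n} - {k}. U_center n A k l * U_center n A' k l / (4 * (\<tau> * \<sigma>)))"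
    by (simp add: sprod_def sum_divide_distrib[symmetric])
  have "\<bar>U_center n A k l * U_center n A' k l / (4 * (\<tau> * \<sigma>))\<bar> \<le> 81 / 4 * (\<tau> * \<sigma> * \<alpha> * \<beta>) \<and>
    \<bar>U_center n (\<lambda>k l. sqrt (A k l)) k l * U_center n (\<lambda>k l. sqrt (A' k l)) k l
       - U_center n A k l * U_center n A' k l / (4 * (\<tau> * \<sigma>))\<bar>
    \<le> 81 / 4 * (\<tau> * \<sigma> * (\<alpha> * \<beta>\<^sup>2 + \<alpha>\<^sup>2 * \<beta> + \<alpha>\<^sup>2 * \<beta>\<^sup>2))"
    if kl: "k \<in> {1..n}" "l \<in> {1..n}" for k l
  proof -
    obtain u r where ur: "U_center n A k l = \<tau>\<^sup>2 * u"
      "U_center n (\<lambda>k l. sqrt (A k l)) k l = \<tau> * (u / 2 + r)"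
      "\<bar>u\<bar> \<le> 9 * \<alpha>" "\<bar>r\<bar> \<le> 9 * (\<alpha>\<^sup>2 / 2)"
      by (rule U_center_expansion[OF n pos(1) A pos(3) kl])
    obtain v s where vs: "U_center n A' k l = \<sigma>\<^sup>2 * v"
      "U_center n (\<lambda>k l. sqrt (A' k l)) k l = \<sigma> * (v / 2 + s)"
      "\<bar>v\<bar> \<le> 9 * \<beta>" "\<bar>s\<bar> \<le> 9 * (\<beta>\<^sup>2 / 2)"
      by (rule U_center_expansion[OF n pos(2) A' pos(4) kl])
    have lead: "U_center n A k l * U_center n A' k l / (4 * (\<tau> * \<sigma>)) = \<tau> * \<sigma> * (u * v / 4)"
      using pos by (simp add: ur vs field_simps power2_eq_square)
    have rem: "\<tau> * (u / 2 + r) * (\<sigma> * (v / 2 + s)) - \<tau> * \<sigma> * (u * v / 4)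
        = \<tau> * \<sigma> * (u * s / 2 + r * v / 2 + r * s)"
      by (simp add: algebra_simps)
    have ineq: "\<bar>u * v\<bar> \<le> (9 * \<alpha>) * (9 * \<beta>)" "\<bar>u * s\<bar> \<le> (9 * \<alpha>) * (9 * (\<beta>\<^sup>2 / 2))"
      "\<bar>r * v\<bar> \<le> (9 * (\<alpha>\<^sup>2 / 2)) * (9 * \<beta>)" "\<bar>r * s\<bar> \<le> (9 * (\<alpha>\<^sup>2 / 2)) * (9 * (\<beta>\<^sup>2 / 2))"
      unfolding abs_mult by (rule mult_mono; use ur vs pos in simp)+
    have "\<bar>u * v / 4\<bar> \<le> 81 / 4 * (\<alpha> * \<beta>)" using ineq(1) by simp
    moreover have "\<bar>u * s / 2 + r * v / 2 + r * s\<bar> \<le> 81 / 4 * (\<alpha> * \<beta>\<^sup>2 + \<alpha>\<^sup>2 * \<beta> + \<alpha>\<^sup>2 * \<beta>\<^sup>2)"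
      using ineq(2-4) by (simp add: algebra_simps)
    ultimately have "\<tau> * \<sigma> * \<bar>u * v / 4\<bar> \<le> \<tau> * \<sigma> * (81 / 4 * (\<alpha> * \<beta>))"
      "\<tau> * \<sigma> * \<bar>u * s / 2 + r * v / 2 + r * s\<bar>
        \<le> \<tau> * \<sigma> * (81 / 4 * (\<alpha> * \<beta>\<^sup>2 + \<alpha>\<^sup>2 * \<beta> + \<alpha>\<^sup>2 * \<beta>\<^sup>2))"
      using pos by (auto intro!: mult_left_mono)
    then show ?thesis
      unfolding lead ur(2) vs(2) rem abs_mult[of "\<tau> * \<sigma>"] using pos by (simp add: ac_simps)
  qed
  note term_bounds = this[THEN conjunct1] this[THEN conjunct2]
  show ?lead unfolding scale
    by (rule order_trans[OF U_average_bound[OF n]], erule (1) term_bounds(1), simp)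
  have diff: "sprod (\<lambda>k l. sqrt (A k l)) (\<lambda>k l. sqrt (A' k l)) - 1 / (4 * (\<tau> * \<sigma>)) * sprod A A'
     = ?c * (\<Sum>k=1..n. \<Sum>l\<in>{1..n} - {k}.
         U_center n (\<lambda>k l. sqrt (A k l)) k l * U_center n (\<lambda>k l. sqrt (A' k l)) k l
         - U_center n A k l * U_center n A' k l / (4 * (\<tau> * \<sigma>)))"
    unfolding scale by (simp add: sprod_def sum_subtractf right_diff_distrib)
  show ?rem unfolding diff
    by (rule order_trans[OF U_average_bound[OF n]], erule (1) term_bounds(2), simp)
qed

text \<open>U-centering is linear in the matrix, so the double sum over groups factors entrywise
  into the centered sum over \<open>i\<close> times the centered sum over \<open>j\<close>. This
  turns the leading term into an average of products for the two matrices of summed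
  distances.\<close>

lemma sum_D2_eq:
  "(\<Sum>i=1..p. \<Sum>j=1..q. D2 n (\<rho> i) (\<rho>' j) (\<lambda>k. U k i) (\<lambda>k. V k j)) =
   1 / (real n * (real n - 3)) * (\<Sum>k=1..n. \<Sum>l\<in>{1..n} - {k}.
     U_center n (\<lambda>k l. \<Sum>i=1..p. \<rho> i (U k i) (U l i)) k l *
     U_center n (\<lambda>k l. \<Sum>j=1..q. \<rho>' j (V k j) (V l j)) k l)"
  (is "_ = ?c * _")
proof -
  let ?a = "\<lambda>i. U_center n (\<lambda>k l. \<rho> i (U k i) (U l i))"
  let ?b = "\<lambda>j. U_center n (\<lambda>k l. \<rho>' j (V k j) (V l j))"
  \<comment> \<open>Four swaps bring the order \<open>i, j, k, l\<close> to
    \<open>k, l, i, j\<close>, after which \<open>sum_product\<close> factors the inner double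
    sum.\<close>
  have "(\<Sum>i=1..p. \<Sum>j=1..q. \<Sum>k=1..n. \<Sum>l\<in>{1..n} - {k}. ?a i k l * ?b j k l)
      = (\<Sum>i=1..p. \<Sum>k=1..n. \<Sum>j=1..q. \<Sum>l\<in>{1..n} - {k}. ?a i k l * ?b j k l)"
    by (intro sum.cong refl sum.swap)
  also have "\<dots> = (\<Sum>k=1..n. \<Sum>i=1..p. \<Sum>j=1..q. \<Sum>l\<in>{1..n} - {k}. ?a i k l * ?b j k l)"
    by (rule sum.swap)
  also have "\<dots> = (\<Sum>k=1..n. \<Sum>i=1..p. \<Sum>l\<in>{1..n} - {k}. \<Sum>j=1..q. ?a i k l * ?b j k l)"
    by (intro sum.cong refl sum.swap)
  also have "\<dots> = (\<Sum>k=1..n. \<Sum>l\<in>{1..n} - {k}. \<Sum>i=1..p. \<Sum>j=1..q. ?a i k l * ?b j k l)"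
    by (intro sum.cong refl sum.swap)
  finally show ?thesis
    by (simp add: D2_def U_center_sum sum_product sum_divide_distrib[symmetric])
qed

section \<open>Distances between grouped vectors\<close>

lemma case_S_nonneg:
  assumes "case_S1 p d \<rho> \<or> case_S2 p d \<rho>" "i \<in> {1..p}"
    "u \<in> space (euclid (d i))" "v \<in> space (euclid (d i))"
  shows "0 \<le> \<rho> i u v"
  using assms(1)
proof
  assume "case_S1 p d \<rho>"
  then have "Metric_space (space (euclid (d i))) (\<rho> i)" using assms(2) by (simp add: case_S1_def)
  then show ?thesis by (rule Metric_space.nonneg)
next
  assume "case_S2 p d \<rho>"
  then show ?thesis using assms(2-4) by (simp add: case_S2_def sum_nonneg)
qed

lemma case_S_refl:
  assumes "case_S1 p d \<rho> \<or> case_S2 p d \<rho>" "i \<in> {1..p}" "u \<in> space (euclid (d i))"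
  shows "\<rho> i u u = 0"
  using assms(1)
proof
  assume "case_S1 p d \<rho>"
  then have "Metric_space (space (euclid (d i))) (\<rho> i)" using assms(2) by (simp add: case_S1_def)
  then show ?thesis using assms(3) by (simp add: Metric_space.zero)
next
  assume "case_S2 p d \<rho>"
  then show ?thesis using assms(2,3) by (simp add: case_S2_def)
qed

lemma grouped_component:
  assumes "x \<in> space (grouped p d)" "i \<in> {1..p}"
  shows "x i \<in> space (euclid (d i))"
  using assms by (auto simp: grouped_def space_PiM)

lemma sum_rho_nonneg:
  assumes "case_S1 p d \<rho> \<or> case_S2 p d \<rho>"
    and "x \<in> space (grouped p d)" "x' \<in> space (grouped p d)"
  shows "0 \<le> (\<Sum>i=1..p. \<rho> i (x i) (x' i))"
proof (rule sum_nonneg)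
  fix i assume i: "i \<in> {1..p}"
  show "0 \<le> \<rho> i (x i) (x' i)"
    by (rule case_S_nonneg[OF assms(1) i grouped_component[OF assms(2) i] grouped_component[OF assms(3) i]])
qed

text \<open>The total function \<open>sqrt\<close> satisfies
  \<open>(sqrt x)\<^sup>2 = \<bar>x\<bar>\<close>, so nonnegativity of the summed distances is what
  recovers the sum.\<close>

lemma K_power2:
  assumes "case_S1 p d \<rho> \<or> case_S2 p d \<rho>"
    and "x \<in> space (grouped p d)" "x' \<in> space (grouped p d)"
  shows "(K p \<rho> x x')\<^sup>2 = (\<Sum>i=1..p. \<rho> i (x i) (x' i))"
  using sum_rho_nonneg[OF assms] by (simp add: K_def)

text \<open>The deterministic core: \<open>U\<close> and \<open>V\<close> are one realization of the
  samples, and \<alpha>, \<beta> bound all off-diagonal deviations at once. The matrices of summed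
  distances are nonnegative with zero diagonal, and their entrywise roots are the matrices of
  \<open>K\<close>.\<close>

lemma D2_K_expansion:
  assumes n: "n \<ge> 4" and pos: "\<tau> > 0" "\<sigma> > 0" "\<alpha> \<ge> 0" "\<beta> \<ge> 0"
    and \<rho>: "case_S1 p d \<rho> \<or> case_S2 p d \<rho>" and \<rho>': "case_S1 q g \<rho>' \<or> case_S2 q g \<rho>'"
    and U: "\<And>k. k \<in> {1..n} \<Longrightarrow> U k \<in> space (grouped p d)"
    and V: "\<And>k. k \<in> {1..n} \<Longrightarrow> V k \<in> space (grouped q g)"
    and devU: "\<And>k l. k \<in> {1..n} \<Longrightarrow> l \<in> {1..n} \<Longrightarrow> k \<noteq> l \<Longrightarrow>
      \<bar>((K p \<rho> (U k) (U l))\<^sup>2 - \<tau>\<^sup>2) / \<tau>\<^sup>2\<bar> \<le> \<alpha>"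
    and devV: "\<And>k l. k \<in> {1..n} \<Longrightarrow> l \<in> {1..n} \<Longrightarrow> k \<noteq> l \<Longrightarrow>
      \<bar>((K q \<rho>' (V k) (V l))\<^sup>2 - \<sigma>\<^sup>2) / \<sigma>\<^sup>2\<bar> \<le> \<beta>"
  defines "lead \<equiv> 1 / (4 * (\<tau> * \<sigma>)) *
      (\<Sum>i=1..p. \<Sum>j=1..q. D2 n (\<rho> i) (\<rho>' j) (\<lambda>k. U k i) (\<lambda>k. V k j))"
  shows "\<bar>lead\<bar> \<le> 81 * (\<tau> * \<sigma> * \<alpha> * \<beta>)"
    and "\<bar>D2 n (K p \<rho>) (K q \<rho>') U V - lead\<bar>
      \<le> 81 * (\<tau> * \<sigma> * (\<alpha> * \<beta>\<^sup>2 + \<alpha>\<^sup>2 * \<beta> + \<alpha>\<^sup>2 * \<beta>\<^sup>2))"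
proof -
  have A: "(\<Sum>i=1..p. \<rho> i (U k i) (U k i)) = 0" if "k \<in> {1..n}" for k
    by (rule sum.neutral) (blast intro: case_S_refl[OF \<rho> _ grouped_component[OF U[OF that]]])
  have A': "(\<Sum>j=1..q. \<rho>' j (V k j) (V k j)) = 0" if "k \<in> {1..n}" for k
    by (rule sum.neutral) (blast intro: case_S_refl[OF \<rho>' _ grouped_component[OF V[OF that]]])
  have dU: "\<bar>((\<Sum>i=1..p. \<rho> i (U k i) (U l i)) - \<tau>\<^sup>2) / \<tau>\<^sup>2\<bar> \<le> \<alpha>"
    if "k \<in> {1..n}" "l \<in> {1..n}" "k \<noteq> l" for k l
    using devU[OF that] unfolding K_power2[OF \<rho> U[OF that(1)] U[OF that(2)]] .
  have dV: "\<bar>((\<Sum>j=1..q. \<rho>' j (V k j) (V l j)) - \<sigma>\<^sup>2) / \<sigma>\<^sup>2\<bar> \<le> \<beta>"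
    if "k \<in> {1..n}" "l \<in> {1..n}" "k \<noteq> l" for k l
    using devV[OF that] unfolding K_power2[OF \<rho>' V[OF that(1)] V[OF that(2)]] .
  note expansion = U_product_expansion[
      where A = "\<lambda>k l. \<Sum>i=1..p. \<rho> i (U k i) (U l i)"
        and A' = "\<lambda>k l. \<Sum>j=1..q. \<rho>' j (V k j) (V l j)",
      OF n pos A sum_rho_nonneg[OF \<rho> U U] dU A' sum_rho_nonneg[OF \<rho>' V V] dV]
  show "\<bar>lead\<bar> \<le> 81 * (\<tau> * \<sigma> * \<alpha> * \<beta>)"
    unfolding lead_def sum_D2_eq by (rule expansion(1))
  show "\<bar>D2 n (K p \<rho>) (K q \<rho>') U V - lead\<bar>
      \<le> 81 * (\<tau> * \<sigma> * (\<alpha> * \<beta>\<^sup>2 + \<alpha>\<^sup>2 * \<beta> + \<alpha>\<^sup>2 * \<beta>\<^sup>2))"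
    unfolding lead_def sum_D2_eq unfolding D2_def K_def by (rule expansion(2))
qed

section \<open>Measurability of the distances and positivity of the normalisation\<close>

lemma measurable_rho_component:
  assumes \<rho>: "(\<lambda>(u, v). \<rho> i u v) \<in> borel_measurable (euclid (d i) \<Otimes>\<^sub>M euclid (d i))"
    and i: "i \<in> {1..p}" and f: "f \<in> measurable N (grouped p d)" and g: "g \<in> measurable N (grouped p d)"
  shows "(\<lambda>z. \<rho> i (f z i) (g z i)) \<in> borel_measurable N"
proof -
  have c: "(\<lambda>x. x i) \<in> measurable (grouped p d) (euclid (d i))"
    unfolding grouped_def using i by (rule measurable_component_singleton)
  have "(\<lambda>z. (f z i, g z i)) \<in> measurable N (euclid (d i) \<Otimes>\<^sub>M euclid (d i))"
    by (rule measurable_Pair[OF measurable_compose[OF f c] measurable_compose[OF g c]])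
  from measurable_compose[OF this \<rho>] show ?thesis by simp
qed

text \<open>The maps \<open>f\<close> and \<open>g\<close> are arbitrary so that they can be the
  projections from a pair of joint observations to their two \<open>X\<close> parts or their two
  \<open>Y\<close> parts.\<close>

lemma measurable_K:
  assumes "\<And>i. i \<in> {1..p} \<Longrightarrow>
      (\<lambda>(u, v). \<rho> i u v) \<in> borel_measurable (euclid (d i) \<Otimes>\<^sub>M euclid (d i))"
    and "f \<in> measurable N (grouped p d)" "g \<in> measurable N (grouped p d)"
  shows "(\<lambda>z. K p \<rho> (f z) (g z)) \<in> borel_measurable N"
proof -
  have [measurable]: "(\<lambda>z. \<Sum>i=1..p. \<rho> i (f z i) (g z i)) \<in> borel_measurable N"
    by (intro borel_measurable_sum measurable_rho_component[OF assms(1) _ assms(2,3)])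
  show ?thesis unfolding K_def by measurable
qed

text \<open>A Bochner integral that is not \<open>0\<close> already entails integrability.\<close>

lemma tau_pos:
  assumes "case_S1 p d \<rho> \<or> case_S2 p d \<rho>" and p: "p \<ge> 1"
    and U: "U \<in> measurable M (grouped p d)" and U': "U' \<in> measurable M (grouped p d)"
    and pos: "\<And>i. i \<in> {1..p} \<Longrightarrow> (\<integral>\<omega>. \<rho> i (U \<omega> i) (U' \<omega> i) \<partial>M) > 0"
  shows "tau M (K p \<rho>) U U' > 0"
proof -
  have "(\<integral>\<omega>. (K p \<rho> (U \<omega>) (U' \<omega>))\<^sup>2 \<partial>M) = (\<integral>\<omega>. (\<Sum>i=1..p. \<rho> i (U \<omega> i) (U' \<omega> i)) \<partial>M)"
    using measurable_space[OF U] measurable_space[OF U']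
    by (intro Bochner_Integration.integral_cong refl K_power2[OF assms(1)])
  also have "\<dots> = (\<Sum>i=1..p. \<integral>\<omega>. \<rho> i (U \<omega> i) (U' \<omega> i) \<partial>M)"
    using pos by (intro Bochner_Integration.integral_sum)
      (metis less_irrefl not_integrable_integral_eq)
  also have "\<dots> > 0" using p pos by (intro sum_pos) auto
  finally show ?thesis by (simp add: tau_def)
qed

section \<open>Stochastic order\<close>

text \<open>If \<open>A\<close> is not measurable, its \<open>measure\<close> is 0 by convention, so
  measurability of the larger set suffices.\<close>

lemma (in finite_measure) measure_mono_outer:
  assumes "A \<subseteq> N" "N \<in> sets M"
  shows "measure M A \<le> measure M N"
  using assms finite_measure_mono measure_notin_sets[of A M] by (cases "A \<in> sets M") auto

text \<open>Exceptional sets make the measurability of \<open>Z s\<close> irrelevant.\<close>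

lemma bigO_prob_exceptional:
  assumes M: "\<And>s. prob_space (M s)"
    and good: "\<And>\<epsilon>. \<epsilon> > 0 \<Longrightarrow> \<exists>C>0. \<forall>\<^sub>F s in F. \<exists>N\<in>sets (M s). measure (M s) N \<le> \<epsilon> \<and>
      (\<forall>\<omega>\<in>space (M s) - N. \<bar>Z s \<omega>\<bar> \<le> C * \<bar>r s\<bar>)"
  shows "bigO_prob F M Z r"
  unfolding bigO_prob_def
proof (intro allI impI)
  fix \<epsilon> :: real assume "\<epsilon> > 0"
  then obtain C where "C > 0" and C: "\<forall>\<^sub>F s in F. \<exists>N\<in>sets (M s). measure (M s) N \<le> \<epsilon> \<and>
      (\<forall>\<omega>\<in>space (M s) - N. \<bar>Z s \<omega>\<bar> \<le> C * \<bar>r s\<bar>)" using good by blast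
  from C have "\<forall>\<^sub>F s in F. measure (M s) {\<omega> \<in> space (M s). \<bar>Z s \<omega>\<bar> > C * \<bar>r s\<bar>} \<le> \<epsilon>"
  proof (rule eventually_mono)
    fix s assume "\<exists>N\<in>sets (M s). measure (M s) N \<le> \<epsilon> \<and>
      (\<forall>\<omega>\<in>space (M s) - N. \<bar>Z s \<omega>\<bar> \<le> C * \<bar>r s\<bar>)"
    then obtain N where N: "N \<in> sets (M s)" "measure (M s) N \<le> \<epsilon>"
      "\<forall>\<omega>\<in>space (M s) - N. \<bar>Z s \<omega>\<bar> \<le> C * \<bar>r s\<bar>" by blast
    interpret prob_space "M s" by (rule M)
    have "{\<omega> \<in> space (M s). \<bar>Z s \<omega>\<bar> > C * \<bar>r s\<bar>} \<subseteq> N" using N(3) by force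
    from measure_mono_outer[OF this N(1)] N(2)
    show "measure (M s) {\<omega> \<in> space (M s). \<bar>Z s \<omega>\<bar> > C * \<bar>r s\<bar>} \<le> \<epsilon>" by linarith
  qed
  then show "\<exists>C>0. \<forall>\<^sub>F s in F. measure (M s) {\<omega> \<in> space (M s). \<bar>Z s \<omega>\<bar> > C * \<bar>r s\<bar>} \<le> \<epsilon>"
    using \<open>C > 0\<close> by blast
qed

text \<open>Since \<open>r\<close> is of smaller order than \<open>r'\<close>, eventually
  \<open>C * \<bar>r s\<bar> \<le> \<epsilon> * \<bar>r' s\<bar>\<close>, and then a violation of
  the \<epsilon> bound can only occur inside the exceptional set. Sets of measure
  \<open>\<delta> / 2\<close> give the strict inequality that convergence requires.\<close>

lemma smallo_prob_exceptional:
  assumes M: "\<And>s. prob_space (M s)"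
    and good: "\<And>\<epsilon>. \<epsilon> > 0 \<Longrightarrow> \<exists>C>0. \<forall>\<^sub>F s in F. \<exists>N\<in>sets (M s). measure (M s) N \<le> \<epsilon> \<and>
      (\<forall>\<omega>\<in>space (M s) - N. \<bar>Z s \<omega>\<bar> \<le> C * \<bar>r s\<bar>)"
    and r: "r \<in> o[F](r')"
  shows "smallo_prob F M Z r'"
  unfolding smallo_prob_def
proof (intro allI impI)
  fix \<epsilon> :: real assume \<epsilon>: "\<epsilon> > 0"
  show "((\<lambda>s. measure (M s) {\<omega> \<in> space (M s). \<bar>Z s \<omega>\<bar> > \<epsilon> * \<bar>r' s\<bar>}) \<longlongrightarrow> 0) F"
  proof (rule tendstoI)
    fix \<delta> :: real assume \<delta>: "\<delta> > 0"
    obtain C where "C > 0" and C: "\<forall>\<^sub>F s in F. \<exists>N\<in>sets (M s). measure (M s) N \<le> \<delta> / 2 \<and>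
        (\<forall>\<omega>\<in>space (M s) - N. \<bar>Z s \<omega>\<bar> \<le> C * \<bar>r s\<bar>)" using good[of "\<delta> / 2"] \<delta> by auto
    have "\<forall>\<^sub>F s in F. \<bar>r s\<bar> \<le> \<epsilon> / C * \<bar>r' s\<bar>"
      using landau_o.smallD[OF r, of "\<epsilon> / C"] \<epsilon> \<open>C > 0\<close> by simp
    with C show "\<forall>\<^sub>F s in F. dist (measure (M s) {\<omega> \<in> space (M s). \<bar>Z s \<omega>\<bar> > \<epsilon> * \<bar>r' s\<bar>}) 0 < \<delta>"
    proof eventually_elim
      case (elim s)
      then obtain N where N: "N \<in> sets (M s)" "measure (M s) N \<le> \<delta> / 2"
        "\<forall>\<omega>\<in>space (M s) - N. \<bar>Z s \<omega>\<bar> \<le> C * \<bar>r s\<bar>" by blast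
      interpret prob_space "M s" by (rule M)
      have "C * \<bar>r s\<bar> \<le> \<epsilon> * \<bar>r' s\<bar>" using elim(2) \<open>C > 0\<close> by (simp add: field_simps)
      then have "{\<omega> \<in> space (M s). \<bar>Z s \<omega>\<bar> > \<epsilon> * \<bar>r' s\<bar>} \<subseteq> N" using N(3) by force
      from measure_mono_outer[OF this N(1)] N(2) \<delta> show ?case by simp
    qed
  qed
qed

section \<open>Laws of sample pairs and the exceptional set for fixed dimensions\<close>

text \<open>Both sides are the product of the law of \<open>Z\<close> with itself: each pair is
  independent and all marginals agree.\<close>

lemma distr_iid_pair:
  assumes M: "prob_space M" and ZZ': "indep_copy M S Z Z'" and Zs: "iid_copies M S n Z Zs"
    and kl: "k \<in> {1..n}" "l \<in> {1..n}" "k \<noteq> l"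
  shows "distr M (S \<Otimes>\<^sub>M S) (\<lambda>\<omega>. (Zs k \<omega>, Zs l \<omega>)) = distr M (S \<Otimes>\<^sub>M S) (\<lambda>\<omega>. (Z \<omega>, Z' \<omega>))"
proof -
  interpret prob_space M by (rule M)
  have "indep_vars (\<lambda>_. S) Zs {1..n}" using Zs by (simp add: iid_copies_def)
  \<comment> \<open>Pairwise independence comes from the disjoint index blocks \<open>{k}\<close>
    and \<open>{l}\<close>, followed by projection to the single coordinate of each block.\<close>
  then have "indep_var (Pi\<^sub>M {k} (\<lambda>_. S)) (\<lambda>\<omega>. restrict (\<lambda>i. Zs i \<omega>) {k})
      (Pi\<^sub>M {l} (\<lambda>_. S)) (\<lambda>\<omega>. restrict (\<lambda>i. Zs i \<omega>) {l})"
    using kl by (intro indep_var_restrict) auto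
  from indep_var_compose[OF this measurable_component_singleton[of k] measurable_component_singleton[of l]]
  have "indep_var S (Zs k) S (Zs l)" by (simp add: o_def)
  moreover have "indep_var S Z S Z'" using ZZ' by (simp add: indep_copy_def)
  ultimately show ?thesis
    using Zs ZZ' kl by (auto simp: indep_var_distribution_eq iid_copies_def indep_copy_def)
qed

text \<open>Every off-diagonal pair has the law of \<open>(Z, Z')\<close>, so the events in the
  union are equally likely, and there are at most \<open>n\<^sup>2\<close> of them. As
  \<open>n\<close> is fixed, this factor is a constant.\<close>

lemma iid_pairs_union_bound:
  fixes f :: "'z \<Rightarrow> 'z \<Rightarrow> real" and c :: real
  assumes M: "prob_space M" and ZZ': "indep_copy M S Z Z'" and Zs: "iid_copies M S n Z Zs"
    and f: "(\<lambda>(z, z'). f z z') \<in> borel_measurable (S \<Otimes>\<^sub>M S)"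
  defines "N \<equiv> (\<Union>(k, l)\<in>{(k, l). k \<in> {1..n} \<and> l \<in> {1..n} \<and> k \<noteq> l}.
      {\<omega> \<in> space M. \<bar>f (Zs k \<omega>) (Zs l \<omega>)\<bar> > c})"
  shows "N \<in> sets M"
    and "measure M N \<le> (real n)\<^sup>2 * measure M {\<omega> \<in> space M. \<bar>f (Z \<omega>) (Z' \<omega>)\<bar> > c}"
proof -
  interpret prob_space M by (rule M)
  let ?I = "{(k, l). k \<in> {1..n} \<and> l \<in> {1..n} \<and> k \<noteq> l}"
  let ?E = "\<lambda>k l. {\<omega> \<in> space M. \<bar>f (Zs k \<omega>) (Zs l \<omega>)\<bar> > c}"
  define F where "F = (\<lambda>(z, z'). f z z')"
  let ?T = "{z \<in> space (S \<Otimes>\<^sub>M S). \<bar>F z\<bar> > c}"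
  have fin: "finite ?I" by (rule finite_subset[of _ "{1..n} \<times> {1..n}"]) auto
  have [measurable]: "F \<in> borel_measurable (S \<Otimes>\<^sub>M S)" using f by (simp add: F_def)
  have T: "?T \<in> sets (S \<Otimes>\<^sub>M S)" by measurable
  have Zs_meas: "Zs k \<in> measurable M S" if "k \<in> {1..n}" for k
    using Zs that by (auto simp: iid_copies_def indep_vars_def)
  have Z_meas: "Z \<in> measurable M S" "Z' \<in> measurable M S"
    using ZZ' by (auto simp: indep_copy_def dest: indep_var_rv1 indep_var_rv2)
  \<comment> \<open>All the events are preimages of the same set \<open>?T\<close> under a pair map,
    so their probabilities depend only on the joint law of the pair.\<close>
  have law: "{\<omega> \<in> space M. \<bar>f (U \<omega>) (V \<omega>)\<bar> > c} \<in> sets M \<and>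
      measure M {\<omega> \<in> space M. \<bar>f (U \<omega>) (V \<omega>)\<bar> > c}
        = measure (distr M (S \<Otimes>\<^sub>M S) (\<lambda>\<omega>. (U \<omega>, V \<omega>))) ?T"
    if U: "U \<in> measurable M S" and V: "V \<in> measurable M S" for U V
  proof -
    have UV: "(\<lambda>\<omega>. (U \<omega>, V \<omega>)) \<in> measurable M (S \<Otimes>\<^sub>M S)" using U V by simp
    have eq: "(\<lambda>\<omega>. (U \<omega>, V \<omega>)) -` ?T \<inter> space M = {\<omega> \<in> space M. \<bar>f (U \<omega>) (V \<omega>)\<bar> > c}"
      using measurable_space[OF UV] by (auto simp: F_def)
    show ?thesis using measurable_sets[OF UV T] measure_distr[OF UV T] unfolding eq by simp
  qed
  have sets: "?E k l \<in> sets M" if "(k, l) \<in> ?I" for k l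
    using law[OF Zs_meas Zs_meas, of k l] that by simp
  have E: "measure M (?E k l) = measure M {\<omega> \<in> space M. \<bar>f (Z \<omega>) (Z' \<omega>)\<bar> > c}"
    if "(k, l) \<in> ?I" for k l
  proof -
    have kl: "k \<in> {1..n}" "l \<in> {1..n}" "k \<noteq> l" using that by auto
    show ?thesis
      using law[OF Zs_meas[OF kl(1)] Zs_meas[OF kl(2)]] law[OF Z_meas]
      unfolding distr_iid_pair[OF M ZZ' Zs kl] by metis
  qed
  show "N \<in> sets M" unfolding N_def using fin sets by (intro sets.finite_UN) auto
  have "measure M N \<le> (\<Sum>(k, l)\<in>?I. measure M (?E k l))"
    unfolding N_def case_prod_unfold
    using fin sets by (intro finite_measure_subadditive_finite) (auto simp: case_prod_unfold)
  also have "\<dots> = real (card ?I) * measure M {\<omega> \<in> space M. \<bar>f (Z \<omega>) (Z' \<omega>)\<bar> > c}"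
    using E by (simp add: case_prod_unfold)
  also have "\<dots> \<le> (real n)\<^sup>2 * measure M {\<omega> \<in> space M. \<bar>f (Z \<omega>) (Z' \<omega>)\<bar> > c}"
  proof (rule mult_right_mono)
    have "card ?I \<le> card ({1..n} \<times> {1..n})" by (intro card_mono) auto
    then show "real (card ?I) \<le> (real n)\<^sup>2"
      by (simp add: power2_eq_square flip: of_nat_mult)
  qed simp
  finally show "measure M N \<le> (real n)\<^sup>2 * measure M {\<omega> \<in> space M. \<bar>f (Z \<omega>) (Z' \<omega>)\<bar> > c}" .
qed

text \<open>For fixed \<open>p\<close> and \<open>q\<close>, the exceptional set collects the
  outcomes where some sample pair has an \<open>X\<close> deviation above \<alpha> or a
  \<open>Y\<close> deviation above \<beta>. Outside it the deterministic expansion applies, and the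
  union bound reduces its measure to the tails of \<open>L_dev\<close>.\<close>

lemma D2_K_exceptional:
  fixes \<alpha> \<beta> :: real
  assumes n: "n \<ge> 4" and pq: "p \<ge> 1" "q \<ge> 1" and bounds: "\<alpha> \<ge> 0" "\<beta> \<ge> 0"
    and \<rho>: "case_S1 p d \<rho> \<or> case_S2 p d \<rho>" and \<rho>': "case_S1 q g \<rho>' \<or> case_S2 q g \<rho>'"
    and \<rho>_meas: "\<And>i. i \<in> {1..p} \<Longrightarrow>
      (\<lambda>(u, v). \<rho> i u v) \<in> borel_measurable (euclid (d i) \<Otimes>\<^sub>M euclid (d i))"
    and \<rho>'_meas: "\<And>j. j \<in> {1..q} \<Longrightarrow>
      (\<lambda>(u, v). \<rho>' j u v) \<in> borel_measurable (euclid (g j) \<Otimes>\<^sub>M euclid (g j))"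
    and M: "prob_space M"
    and copy: "indep_copy M (grouped p d \<Otimes>\<^sub>M grouped q g) (\<lambda>\<omega>. (X \<omega>, Y \<omega>)) (\<lambda>\<omega>. (X' \<omega>, Y' \<omega>))"
    and iid: "iid_copies M (grouped p d \<Otimes>\<^sub>M grouped q g) n (\<lambda>\<omega>. (X \<omega>, Y \<omega>))
      (\<lambda>k \<omega>. (Xs k \<omega>, Ys k \<omega>))"
    and E\<rho>: "\<And>i. i \<in> {1..p} \<Longrightarrow> (\<integral>\<omega>. \<rho> i (X \<omega> i) (X' \<omega> i) \<partial>M) > 0"
    and E\<rho>': "\<And>j. j \<in> {1..q} \<Longrightarrow> (\<integral>\<omega>. \<rho>' j (Y \<omega> j) (Y' \<omega> j) \<partial>M) > 0"
  defines "\<tau> \<equiv> tau M (K p \<rho>) X X'" and "\<sigma> \<equiv> tau M (K q \<rho>') Y Y'"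
  defines "lead \<equiv> \<lambda>\<omega>. 1 / (4 * (\<tau> * \<sigma>)) *
      (\<Sum>i=1..p. \<Sum>j=1..q. D2 n (\<rho> i) (\<rho>' j) (\<lambda>k. Xs k \<omega> i) (\<lambda>k. Ys k \<omega> j))"
  shows "\<tau> > 0" "\<sigma> > 0"
    and "\<exists>N\<in>sets M. measure M N \<le> (real n)\<^sup>2 *
        (measure M {\<omega> \<in> space M. \<bar>L_dev M (K p \<rho>) X X' \<omega>\<bar> > \<alpha>}
         + measure M {\<omega> \<in> space M. \<bar>L_dev M (K q \<rho>') Y Y' \<omega>\<bar> > \<beta>}) \<and>
      (\<forall>\<omega>\<in>space M - N. \<bar>lead \<omega>\<bar> \<le> 81 * (\<tau> * \<sigma> * \<alpha> * \<beta>) \<and>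
        \<bar>D2 n (K p \<rho>) (K q \<rho>') (\<lambda>k. Xs k \<omega>) (\<lambda>k. Ys k \<omega>) - lead \<omega>\<bar>
          \<le> 81 * (\<tau> * \<sigma> * (\<alpha> * \<beta>\<^sup>2 + \<alpha>\<^sup>2 * \<beta> + \<alpha>\<^sup>2 * \<beta>\<^sup>2)))"
proof -
  interpret prob_space M by (rule M)
  let ?G = "grouped p d" and ?G' = "grouped q g"
  have Z: "(\<lambda>\<omega>. (X \<omega>, Y \<omega>)) \<in> measurable M (?G \<Otimes>\<^sub>M ?G')"
    and Z': "(\<lambda>\<omega>. (X' \<omega>, Y' \<omega>)) \<in> measurable M (?G \<Otimes>\<^sub>M ?G')"
    using copy by (auto simp: indep_copy_def dest: indep_var_rv1 indep_var_rv2)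
  have X: "X \<in> measurable M ?G" "X' \<in> measurable M ?G" and Y: "Y \<in> measurable M ?G'" "Y' \<in> measurable M ?G'"
    using measurable_compose[OF Z measurable_fst] measurable_compose[OF Z' measurable_fst]
      measurable_compose[OF Z measurable_snd] measurable_compose[OF Z' measurable_snd] by simp_all
  show \<tau>: "\<tau> > 0" unfolding \<tau>_def by (rule tau_pos[OF \<rho> pq(1) X E\<rho>])
  show \<sigma>: "\<sigma> > 0" unfolding \<sigma>_def by (rule tau_pos[OF \<rho>' pq(2) Y E\<rho>'])
  have sample: "(Xs k \<omega>, Ys k \<omega>) \<in> space (?G \<Otimes>\<^sub>M ?G')" if "\<omega> \<in> space M" "k \<in> {1..n}" for \<omega> k
  proof -
    have "(\<lambda>\<omega>. (Xs k \<omega>, Ys k \<omega>)) \<in> measurable M (?G \<Otimes>\<^sub>M ?G')"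
      using iid that(2) unfolding iid_copies_def indep_vars_def by blast
    from measurable_space[OF this that(1)] show ?thesis .
  qed
  \<comment> \<open>Both deviations are functions of two joint observations \<open>(x, y)\<close>,
    so the single i.i.d. hypothesis on the pairs serves \<open>X\<close> and \<open>Y\<close>,
    whatever their dependence. At \<open>(X, Y)\<close> and \<open>(X', Y')\<close> they equal
    \<open>L_dev\<close>.\<close>
  define f f' :: "(nat \<Rightarrow> nat \<Rightarrow> real) \<times> (nat \<Rightarrow> nat \<Rightarrow> real) \<Rightarrow> _"
    where "f z z' = ((K p \<rho> (fst z) (fst z'))\<^sup>2 - \<tau>\<^sup>2) / \<tau>\<^sup>2"
      and "f' z z' = ((K q \<rho>' (snd z) (snd z'))\<^sup>2 - \<sigma>\<^sup>2) / \<sigma>\<^sup>2" for z z'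
  let ?S = "(?G \<Otimes>\<^sub>M ?G') \<Otimes>\<^sub>M (?G \<Otimes>\<^sub>M ?G')"
  have KX: "(\<lambda>z. K p \<rho> (fst (fst z)) (fst (snd z))) \<in> borel_measurable ?S"
    using \<rho>_meas by (rule measurable_K) (assumption, measurable)
  have KY: "(\<lambda>z. K q \<rho>' (snd (fst z)) (snd (snd z))) \<in> borel_measurable ?S"
    using \<rho>'_meas by (rule measurable_K) (assumption, measurable)
  have f: "(\<lambda>(z, z'). f z z') \<in> borel_measurable ?S"
    unfolding f_def case_prod_beta using KX by measurable
  have f': "(\<lambda>(z, z'). f' z z') \<in> borel_measurable ?S"
    unfolding f'_def case_prod_beta using KY by measurable
  let ?N = "\<lambda>f c. \<Union>(k, l)\<in>{(k, l). k \<in> {1..n} \<and> l \<in> {1..n} \<and> k \<noteq> l}.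
      {\<omega> \<in> space M. \<bar>f (Xs k \<omega>, Ys k \<omega>) (Xs l \<omega>, Ys l \<omega>)\<bar> > c}"
  note N = iid_pairs_union_bound[OF M copy iid f, of \<alpha>]
  note N' = iid_pairs_union_bound[OF M copy iid f', of \<beta>]
  have "measure M (?N f \<alpha> \<union> ?N f' \<beta>) \<le> measure M (?N f \<alpha>) + measure M (?N f' \<beta>)"
    using N(1) N'(1) by (rule measure_Un_le)
  also have "\<dots> \<le> (real n)\<^sup>2 * measure M {\<omega> \<in> space M. \<bar>f (X \<omega>, Y \<omega>) (X' \<omega>, Y' \<omega>)\<bar> > \<alpha>}
      + (real n)\<^sup>2 * measure M {\<omega> \<in> space M. \<bar>f' (X \<omega>, Y \<omega>) (X' \<omega>, Y' \<omega>)\<bar> > \<beta>}"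
    using N(2) N'(2) by (rule add_mono)
  also have "\<dots> = (real n)\<^sup>2 *
        (measure M {\<omega> \<in> space M. \<bar>L_dev M (K p \<rho>) X X' \<omega>\<bar> > \<alpha>}
         + measure M {\<omega> \<in> space M. \<bar>L_dev M (K q \<rho>') Y Y' \<omega>\<bar> > \<beta>})"
    by (simp add: f_def f'_def L_dev_def \<tau>_def \<sigma>_def distrib_left)
  finally have bound: "measure M (?N f \<alpha> \<union> ?N f' \<beta>) \<le> \<dots>" .
  show "\<exists>N\<in>sets M. measure M N \<le> (real n)\<^sup>2 *
        (measure M {\<omega> \<in> space M. \<bar>L_dev M (K p \<rho>) X X' \<omega>\<bar> > \<alpha>}
         + measure M {\<omega> \<in> space M. \<bar>L_dev M (K q \<rho>') Y Y' \<omega>\<bar> > \<beta>}) \<and>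
      (\<forall>\<omega>\<in>space M - N. \<bar>lead \<omega>\<bar> \<le> 81 * (\<tau> * \<sigma> * \<alpha> * \<beta>) \<and>
        \<bar>D2 n (K p \<rho>) (K q \<rho>') (\<lambda>k. Xs k \<omega>) (\<lambda>k. Ys k \<omega>) - lead \<omega>\<bar>
          \<le> 81 * (\<tau> * \<sigma> * (\<alpha> * \<beta>\<^sup>2 + \<alpha>\<^sup>2 * \<beta> + \<alpha>\<^sup>2 * \<beta>\<^sup>2)))"
  proof (intro bexI[of _ "?N f \<alpha> \<union> ?N f' \<beta>"] conjI ballI)
    show "?N f \<alpha> \<union> ?N f' \<beta> \<in> sets M" using N(1) N'(1) by (rule sets.Un)
  next
    fix \<omega> assume \<omega>: "\<omega> \<in> space M - (?N f \<alpha> \<union> ?N f' \<beta>)"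
    have devX: "\<bar>((K p \<rho> (Xs k \<omega>) (Xs l \<omega>))\<^sup>2 - \<tau>\<^sup>2) / \<tau>\<^sup>2\<bar> \<le> \<alpha>"
      and devY: "\<bar>((K q \<rho>' (Ys k \<omega>) (Ys l \<omega>))\<^sup>2 - \<sigma>\<^sup>2) / \<sigma>\<^sup>2\<bar> \<le> \<beta>"
      if "k \<in> {1..n}" "l \<in> {1..n}" "k \<noteq> l" for k l
    proof -
      have "\<not> \<bar>f (Xs k \<omega>, Ys k \<omega>) (Xs l \<omega>, Ys l \<omega>)\<bar> > \<alpha>"
        "\<not> \<bar>f' (Xs k \<omega>, Ys k \<omega>) (Xs l \<omega>, Ys l \<omega>)\<bar> > \<beta>"
        using \<omega> that by blast+
      then show "\<bar>((K p \<rho> (Xs k \<omega>) (Xs l \<omega>))\<^sup>2 - \<tau>\<^sup>2) / \<tau>\<^sup>2\<bar> \<le> \<alpha>"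
        "\<bar>((K q \<rho>' (Ys k \<omega>) (Ys l \<omega>))\<^sup>2 - \<sigma>\<^sup>2) / \<sigma>\<^sup>2\<bar> \<le> \<beta>"
        by (simp_all add: f_def f'_def not_less)
    qed
    have spaces: "Xs k \<omega> \<in> space ?G" "Ys k \<omega> \<in> space ?G'" if "k \<in> {1..n}" for k
      using sample[OF _ that] \<omega> by (auto simp: space_pair_measure)
    note expansion = D2_K_expansion[where U = "\<lambda>k. Xs k \<omega>" and V = "\<lambda>k. Ys k \<omega>",
        OF n \<tau> \<sigma> bounds \<rho> \<rho>' spaces devX devY]
    show "\<bar>lead \<omega>\<bar> \<le> 81 * (\<tau> * \<sigma> * \<alpha> * \<beta>)"
      unfolding lead_def by (rule expansion(1))
    show "\<bar>D2 n (K p \<rho>) (K q \<rho>') (\<lambda>k. Xs k \<omega>) (\<lambda>k. Ys k \<omega>) - lead \<omega>\<bar>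
          \<le> 81 * (\<tau> * \<sigma> * (\<alpha> * \<beta>\<^sup>2 + \<alpha>\<^sup>2 * \<beta> + \<alpha>\<^sup>2 * \<beta>\<^sup>2))"
      unfolding lead_def by (rule expansion(2))
  qed (rule bound)
qed

section \<open>The expansion as both dimensions tend to infinity\<close>

text \<open>On each sample space the two equations determine \<open>lead\<close> and
  \<open>R\<close>, so the existential quantifier only names them. That \<open>R\<close> is of
  smaller order than the leading term is expressed by a common rate: \<open>lead\<close> is O_p and
  \<open>R\<close> is o_p of \<open>\<tau>XY p q * a p * b q\<close>. Distances and dimensions form
  triangular arrays, and the probability space may change with \<open>(p, q)\<close>.\<close>

theorem theorem5p3:
  fixes n B :: nat
    and M :: "nat \<Rightarrow> nat \<Rightarrow> 'w measure"
    and d g :: "nat \<Rightarrow> nat \<Rightarrow> nat"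
    and \<rho>X \<rho>Y :: "nat \<Rightarrow> nat \<Rightarrow> (nat \<Rightarrow> real) \<Rightarrow> (nat \<Rightarrow> real) \<Rightarrow> real"
    and X X' Y Y' :: "nat \<Rightarrow> nat \<Rightarrow> 'w \<Rightarrow> nat \<Rightarrow> nat \<Rightarrow> real"
    and Xs Ys :: "nat \<Rightarrow> nat \<Rightarrow> nat \<Rightarrow> 'w \<Rightarrow> nat \<Rightarrow> nat \<Rightarrow> real"
    and cX CX cY CY cXY CXY :: real
    and a b :: "nat \<Rightarrow> real"
    and \<tau>XY :: "nat \<Rightarrow> nat \<Rightarrow> real"
  defines "\<tau>XY \<equiv> \<lambda>p q. tau (M p q) (K p (\<rho>X p)) (X p q) (X' p q) *
                        tau (M p q) (K q (\<rho>Y q)) (Y p q) (Y' p q)"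
  assumes "n \<ge> 4"
    and "\<And>p i. i \<in> {1..p} \<Longrightarrow> 1 \<le> d p i \<and> d p i \<le> B"
    and "\<And>q j. j \<in> {1..q} \<Longrightarrow> 1 \<le> g q j \<and> g q j \<le> B"
    and "\<And>p. case_S1 p (d p) (\<rho>X p) \<or> case_S2 p (d p) (\<rho>X p)"
    and "\<And>q. case_S1 q (g q) (\<rho>Y q) \<or> case_S2 q (g q) (\<rho>Y q)"
    and "\<And>p i. i \<in> {1..p} \<Longrightarrow>
           (\<lambda>(u, v). \<rho>X p i u v) \<in> borel_measurable (euclid (d p i) \<Otimes>\<^sub>M euclid (d p i))"
    and "\<And>q j. j \<in> {1..q} \<Longrightarrow>
           (\<lambda>(u, v). \<rho>Y q j u v) \<in> borel_measurable (euclid (g q j) \<Otimes>\<^sub>M euclid (g q j))"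
    and "\<And>p q. prob_space (M p q)"
    and "\<And>p q. indep_copy (M p q) (grouped p (d p) \<Otimes>\<^sub>M grouped q (g q))
           (\<lambda>\<omega>. (X p q \<omega>, Y p q \<omega>)) (\<lambda>\<omega>. (X' p q \<omega>, Y' p q \<omega>))"
    and "\<And>p q. iid_copies (M p q) (grouped p (d p) \<Otimes>\<^sub>M grouped q (g q)) n
           (\<lambda>\<omega>. (X p q \<omega>, Y p q \<omega>)) (\<lambda>k \<omega>. (Xs p q k \<omega>, Ys p q k \<omega>))"
    and "0 < cX" "cX \<le> CX" "0 < cY" "cY \<le> CY" "0 < cXY" "cXY \<le> CXY"
    and "\<And>p q i. i \<in> {1..p} \<Longrightarrow>
           (\<integral>\<omega>. \<rho>X p i (X p q \<omega> i) (X' p q \<omega> i) \<partial>M p q) \<in> {cX..CX}"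
    and "\<And>p q j. j \<in> {1..q} \<Longrightarrow>
           (\<integral>\<omega>. \<rho>Y q j (Y p q \<omega> j) (Y' p q \<omega> j) \<partial>M p q) \<in> {cY..CY}"
    and "\<And>p q i. i \<in> {1..min p q} \<Longrightarrow> d p i = g q i \<Longrightarrow>
           (\<And>u v. u \<in> space (euclid (d p i)) \<Longrightarrow> v \<in> space (euclid (d p i)) \<Longrightarrow>
              \<rho>X p i u v = \<rho>Y q i u v) \<Longrightarrow>
           (\<integral>\<omega>. \<rho>X p i (X p q \<omega> i) (Y p q \<omega> i) \<partial>M p q) \<in> {cXY..CXY}"
    and "\<And>p. a p > 0" "\<And>q. b q > 0"
    and "bigO_prob pq_infty (\<lambda>(p, q). M p q)
           (\<lambda>(p, q). L_dev (M p q) (K p (\<rho>X p)) (X p q) (X' p q)) (\<lambda>(p, q). a p)"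
    and "bigO_prob pq_infty (\<lambda>(p, q). M p q)
           (\<lambda>(p, q). L_dev (M p q) (K q (\<rho>Y q)) (Y p q) (Y' p q)) (\<lambda>(p, q). b q)"
    and "a \<in> o(\<lambda>_. 1)" "b \<in> o(\<lambda>_. 1)"
    and "(\<lambda>(p, q). \<tau>XY p q * (a p)\<^sup>2 * b q) \<in> o[pq_infty](\<lambda>_. 1)"
    and "(\<lambda>(p, q). \<tau>XY p q * a p * (b q)\<^sup>2) \<in> o[pq_infty](\<lambda>_. 1)"
  shows "\<exists>lead R :: nat \<Rightarrow> nat \<Rightarrow> 'w \<Rightarrow> real.
     (\<forall>p q. \<forall>\<omega>\<in>space (M p q).
        lead p q \<omega> =
          1 / (4 * \<tau>XY p q) *
          (\<Sum>i=1..p. \<Sum>j=1..q.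
             D2 n (\<rho>X p i) (\<rho>Y q j) (\<lambda>k. Xs p q k \<omega> i) (\<lambda>k. Ys p q k \<omega> j))) \<and>
     (\<forall>p q. \<forall>\<omega>\<in>space (M p q).
        D2 n (K p (\<rho>X p)) (K q (\<rho>Y q)) (\<lambda>k. Xs p q k \<omega>) (\<lambda>k. Ys p q k \<omega>) =
          lead p q \<omega> + R p q \<omega>) \<and>
     bigO_prob pq_infty (\<lambda>(p, q). M p q) (\<lambda>(p, q). R p q)
       (\<lambda>(p, q). \<tau>XY p q * (a p)\<^sup>2 * b q + \<tau>XY p q * a p * (b q)\<^sup>2) \<and>
     smallo_prob pq_infty (\<lambda>(p, q). M p q) (\<lambda>(p, q). R p q) (\<lambda>_. 1) \<and>
     bigO_prob pq_infty (\<lambda>(p, q). M p q) (\<lambda>(p, q). lead p q)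
       (\<lambda>(p, q). \<tau>XY p q * a p * b q) \<and>
     smallo_prob pq_infty (\<lambda>(p, q). M p q) (\<lambda>(p, q). R p q)
       (\<lambda>(p, q). \<tau>XY p q * a p * b q)"
proof -
  define \<tau> where "\<tau> p q = tau (M p q) (K p (\<rho>X p)) (X p q) (X' p q)" for p q
  define \<sigma> where "\<sigma> p q = tau (M p q) (K q (\<rho>Y q)) (Y p q) (Y' p q)" for p q
  have \<tau>XY: "\<tau>XY = (\<lambda>p q. \<tau> p q * \<sigma> p q)" by (simp add: \<tau>XY_def \<tau>_def \<sigma>_def fun_eq_iff)
  have n: "n \<ge> 4" by fact
  have a: "a p > 0" and b: "b q > 0" for p q by fact+
  have M: "prob_space (M p q)" for p q by fact
  have EX: "(\<integral>\<omega>. \<rho>X p i (X p q \<omega> i) (X' p q \<omega> i) \<partial>M p q) > 0" if "i \<in> {1..p}" for p q i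
  proof -
    have "(\<integral>\<omega>. \<rho>X p i (X p q \<omega> i) (X' p q \<omega> i) \<partial>M p q) \<in> {cX..CX}" using that by fact
    then show ?thesis using \<open>0 < cX\<close> by simp
  qed
  have EY: "(\<integral>\<omega>. \<rho>Y q j (Y p q \<omega> j) (Y' p q \<omega> j) \<partial>M p q) > 0" if "j \<in> {1..q}" for p q j
  proof -
    have "(\<integral>\<omega>. \<rho>Y q j (Y p q \<omega> j) (Y' p q \<omega> j) \<partial>M p q) \<in> {cY..CY}" using that by fact
    then show ?thesis using \<open>0 < cY\<close> by simp
  qed
  define LX where "LX p q = L_dev (M p q) (K p (\<rho>X p)) (X p q) (X' p q)" for p q
  define LY where "LY p q = L_dev (M p q) (K q (\<rho>Y q)) (Y p q) (Y' p q)" for p q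
  have LX: "bigO_prob pq_infty (\<lambda>(p, q). M p q) (\<lambda>(p, q). LX p q) (\<lambda>(p, q). a p)"
    and LY: "bigO_prob pq_infty (\<lambda>(p, q). M p q) (\<lambda>(p, q). LY p q) (\<lambda>(p, q). b q)"
    unfolding LX_def LY_def by fact+
  define lead where "lead p q \<omega> = 1 / (4 * \<tau>XY p q) * (\<Sum>i=1..p. \<Sum>j=1..q.
      D2 n (\<rho>X p i) (\<rho>Y q j) (\<lambda>k. Xs p q k \<omega> i) (\<lambda>k. Ys p q k \<omega> j))" for p q \<omega>
  define R where "R p q \<omega> =
      D2 n (K p (\<rho>X p)) (K q (\<rho>Y q)) (\<lambda>k. Xs p q k \<omega>) (\<lambda>k. Ys p q k \<omega>) - lead p q \<omega>" for p q \<omega>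
  define r where "r p q = \<tau>XY p q * (a p)\<^sup>2 * b q + \<tau>XY p q * a p * (b q)\<^sup>2" for p q
  define r' where "r' p q = \<tau>XY p q * a p * b q" for p q

  \<comment> \<open>The premises left open are \<open>p \<ge> 1\<close>, \<open>q \<ge> 1\<close>
    and nonnegativity of \<alpha> and \<beta>, which are chosen later as multiples of
    \<open>a p\<close> and \<open>b q\<close>.\<close>
  note expansion = D2_K_exceptional[where M = "M p q" and X = "X p q" and X' = "X' p q"
      and Y = "Y p q" and Y' = "Y' p q" and Xs = "Xs p q" and Ys = "Ys p q"
      and p = p and q = q and \<rho> = "\<rho>X p" and \<rho>' = "\<rho>Y q" and d = "d p" and g = "g q" for p q,
      OF n _ _ _ _ assms(5,6,7,8) M assms(10,11) EX EY,
      folded \<tau>_def \<sigma>_def LX_def LY_def, folded fun_cong[OF fun_cong[OF \<tau>XY]], folded lead_def]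

  have ev_p: "\<forall>\<^sub>F s in pq_infty. P (fst s)" if "eventually P at_top" for P :: "nat \<Rightarrow> bool"
    using that filterlim_fst by (rule eventually_compose_filterlim)
  have ev_q: "\<forall>\<^sub>F s in pq_infty. P (snd s)" if "eventually P at_top" for P :: "nat \<Rightarrow> bool"
    using that filterlim_snd by (rule eventually_compose_filterlim)
  have a0: "a \<longlonglongrightarrow> 0" and b0: "b \<longlonglongrightarrow> 0"
    using \<open>a \<in> o(\<lambda>_. 1)\<close> \<open>b \<in> o(\<lambda>_. 1)\<close> by (auto dest: smalloD_tendsto)

  \<comment> \<open>One constant and one exceptional set control \<open>lead\<close> and
    \<open>R\<close> together; \<open>good_lead\<close> and \<open>good_R\<close> below merely
    project out the two halves.\<close>
  have key: "\<exists>C>0. \<forall>\<^sub>F s in pq_infty. \<exists>N\<in>sets (case s of (p, q) \<Rightarrow> M p q).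
      measure (case s of (p, q) \<Rightarrow> M p q) N \<le> \<epsilon> \<and>
      (\<forall>\<omega>\<in>space (case s of (p, q) \<Rightarrow> M p q) - N.
        \<bar>(case s of (p, q) \<Rightarrow> lead p q) \<omega>\<bar> \<le> C * \<bar>case s of (p, q) \<Rightarrow> r' p q\<bar> \<and>
        \<bar>(case s of (p, q) \<Rightarrow> R p q) \<omega>\<bar> \<le> C * \<bar>case s of (p, q) \<Rightarrow> r p q\<bar>)"
    (is "\<exists>C>0. \<forall>\<^sub>F s in _. ?good C s") if "\<epsilon> > 0" for \<epsilon>
  proof -
    \<comment> \<open>Two tails of size \<delta>, multiplied by the factor \<open>n\<^sup>2\<close>
      of the union bound, add up to \<epsilon>.\<close>
    define \<delta> where "\<delta> = \<epsilon> / (2 * (real n)\<^sup>2)"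
    have \<delta>: "\<delta> > 0" "(real n)\<^sup>2 * (\<delta> + \<delta>) = \<epsilon>" using n that by (auto simp: \<delta>_def field_simps)
    obtain c where c: "c > 0" "\<forall>\<^sub>F s in pq_infty. measure (case s of (p, q) \<Rightarrow> M p q)
        {\<omega> \<in> space (case s of (p, q) \<Rightarrow> M p q).
          \<bar>(case s of (p, q) \<Rightarrow> LX p q) \<omega>\<bar> > c * \<bar>case s of (p, q) \<Rightarrow> a p\<bar>} \<le> \<delta>"
      using LX \<delta>(1) unfolding bigO_prob_def by blast
    obtain c' where c': "c' > 0" "\<forall>\<^sub>F s in pq_infty. measure (case s of (p, q) \<Rightarrow> M p q)
        {\<omega> \<in> space (case s of (p, q) \<Rightarrow> M p q).
          \<bar>(case s of (p, q) \<Rightarrow> LY p q) \<omega>\<bar> > c' * \<bar>case s of (p, q) \<Rightarrow> b q\<bar>} \<le> \<delta>"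
      using LY \<delta>(1) unfolding bigO_prob_def by blast
    \<comment> \<open>The coefficient \<open>c * c'\<close> serves \<open>lead\<close>; the other
      three are those of the terms of \<open>R\<close> after substituting \<open>c * a p\<close> and
      \<open>c' * b q\<close> for \<alpha> and \<beta>.\<close>
    define C where "C = 81 * (c * c' + c * c'\<^sup>2 + c\<^sup>2 * c' + c\<^sup>2 * c'\<^sup>2)"
    \<comment> \<open>The term of \<open>R\<close> with both squares has no counterpart in the rate
      \<open>r\<close>; \<open>b q \<le> 1\<close> absorbs it into the term with
      \<open>(a p)\<^sup>2 * b q\<close>.\<close>
    have b1: "\<forall>\<^sub>F q in at_top. b q \<le> 1"
      using order_tendstoD(2)[OF b0, of 1] by (auto elim: eventually_mono)
    have "\<forall>\<^sub>F s in pq_infty. \<exists>N\<in>sets (case s of (p, q) \<Rightarrow> M p q).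
      measure (case s of (p, q) \<Rightarrow> M p q) N \<le> \<epsilon> \<and>
      (\<forall>\<omega>\<in>space (case s of (p, q) \<Rightarrow> M p q) - N.
        \<bar>(case s of (p, q) \<Rightarrow> lead p q) \<omega>\<bar> \<le> C * \<bar>case s of (p, q) \<Rightarrow> r' p q\<bar> \<and>
        \<bar>(case s of (p, q) \<Rightarrow> R p q) \<omega>\<bar> \<le> C * \<bar>case s of (p, q) \<Rightarrow> r p q\<bar>)"
      using c(2) c'(2) ev_p[OF eventually_ge_at_top[of 1]] ev_q[OF eventually_ge_at_top[of 1]] ev_q[OF b1]
    proof eventually_elim
      case (elim s)
      obtain p q where s: "s = (p, q)" by (cases s)
      let ?\<alpha> = "c * a p" and ?\<beta> = "c' * b q"
      have pq: "p \<ge> 1" "q \<ge> 1" and b1: "b q \<le> 1" using elim(3-5) by (simp_all add: s)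
      have \<alpha>\<beta>: "0 \<le> ?\<alpha>" "0 \<le> ?\<beta>" using a[of p] b[of q] c(1) c'(1) by simp_all
      have "\<tau>XY p q > 0" using expansion(1,2)[OF pq \<alpha>\<beta>] by (simp add: \<tau>XY)
      have mL: "measure (M p q) {\<omega> \<in> space (M p q). \<bar>LX p q \<omega>\<bar> > ?\<alpha>} \<le> \<delta>"
        "measure (M p q) {\<omega> \<in> space (M p q). \<bar>LY p q \<omega>\<bar> > ?\<beta>} \<le> \<delta>"
        using elim(1,2) a[of p] b[of q] by (simp_all add: s)
      obtain N where N: "N \<in> sets (M p q)"
        and mN: "measure (M p q) N \<le> (real n)\<^sup>2 *
          (measure (M p q) {\<omega> \<in> space (M p q). \<bar>LX p q \<omega>\<bar> > ?\<alpha>}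
           + measure (M p q) {\<omega> \<in> space (M p q). \<bar>LY p q \<omega>\<bar> > ?\<beta>})"
        and lead_le: "\<And>\<omega>. \<omega> \<in> space (M p q) - N \<Longrightarrow> \<bar>lead p q \<omega>\<bar> \<le> 81 * (\<tau>XY p q * ?\<alpha> * ?\<beta>)"
        and R_le: "\<And>\<omega>. \<omega> \<in> space (M p q) - N \<Longrightarrow> \<bar>R p q \<omega>\<bar>
            \<le> 81 * (\<tau>XY p q * (?\<alpha> * ?\<beta>\<^sup>2 + ?\<alpha>\<^sup>2 * ?\<beta> + ?\<alpha>\<^sup>2 * ?\<beta>\<^sup>2))"
        using expansion(3)[OF pq \<alpha>\<beta>] unfolding R_def by blast
      note mN
      also have "(real n)\<^sup>2 *
          (measure (M p q) {\<omega> \<in> space (M p q). \<bar>LX p q \<omega>\<bar> > ?\<alpha>}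
           + measure (M p q) {\<omega> \<in> space (M p q). \<bar>LY p q \<omega>\<bar> > ?\<beta>}) \<le> (real n)\<^sup>2 * (\<delta> + \<delta>)"
        using mL by (intro mult_left_mono add_mono) auto
      finally have mN: "measure (M p q) N \<le> \<epsilon>" using \<delta>(2) by simp
      have r: "r p q \<ge> 0" "r' p q \<ge> 0"
        using \<open>\<tau>XY p q > 0\<close> a[of p] b[of q] by (auto simp: r_def r'_def)
      have "81 * (\<tau>XY p q * ?\<alpha> * ?\<beta>) = 81 * (c * c') * r' p q" by (simp add: r'_def)
      also have "\<dots> \<le> C * r' p q"
        using c(1) c'(1) r(2) by (intro mult_right_mono) (auto simp: C_def)
      finally have leadC: "81 * (\<tau>XY p q * ?\<alpha> * ?\<beta>) \<le> C * r' p q" .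
      define u where "u = \<tau>XY p q * a p * (b q)\<^sup>2"
      define v where "v = \<tau>XY p q * (a p)\<^sup>2 * b q"
      have uv: "0 \<le> u" "0 \<le> v" "r p q = v + u"
        using \<open>\<tau>XY p q > 0\<close> a[of p] b[of q] by (auto simp: u_def v_def r_def)
      have vb: "v * b q \<le> v" using uv(2) b1 by (simp add: mult_left_le)
      have "\<tau>XY p q * (?\<alpha> * ?\<beta>\<^sup>2 + ?\<alpha>\<^sup>2 * ?\<beta> + ?\<alpha>\<^sup>2 * ?\<beta>\<^sup>2)
          = c * c'\<^sup>2 * u + c\<^sup>2 * c' * v + c\<^sup>2 * c'\<^sup>2 * (v * b q)"
        by (simp add: u_def v_def power2_eq_square algebra_simps)
      also have "\<dots> \<le> c * c'\<^sup>2 * r p q + c\<^sup>2 * c' * r p q + c\<^sup>2 * c'\<^sup>2 * r p q"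
        using c(1) c'(1) uv vb by (intro add_mono mult_left_mono) auto
      also have "\<dots> \<le> (c * c' + c * c'\<^sup>2 + c\<^sup>2 * c' + c\<^sup>2 * c'\<^sup>2) * r p q"
        using c(1) c'(1) r(1) by (simp add: algebra_simps)
      finally have "\<tau>XY p q * (?\<alpha> * ?\<beta>\<^sup>2 + ?\<alpha>\<^sup>2 * ?\<beta> + ?\<alpha>\<^sup>2 * ?\<beta>\<^sup>2)
          \<le> (c * c' + c * c'\<^sup>2 + c\<^sup>2 * c' + c\<^sup>2 * c'\<^sup>2) * r p q" .
      from mult_left_mono[OF this, of 81]
      have RC: "81 * (\<tau>XY p q * (?\<alpha> * ?\<beta>\<^sup>2 + ?\<alpha>\<^sup>2 * ?\<beta> + ?\<alpha>\<^sup>2 * ?\<beta>\<^sup>2)) \<le> C * r p q"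
        by (simp only: C_def mult.assoc zero_le_numeral simp_thms True_implies_equals)
      show ?case
        unfolding s prod.case abs_of_nonneg[OF r(1)] abs_of_nonneg[OF r(2)]
        using N mN lead_le R_le leadC RC by (intro bexI[of _ N]) (auto intro: order_trans)
    qed
    moreover have "C > 0" using c(1) c'(1) by (simp add: C_def add_pos_pos)
    ultimately show ?thesis by blast
  qed
  have good_lead: "\<exists>C>0. \<forall>\<^sub>F s in pq_infty. \<exists>N\<in>sets (case s of (p, q) \<Rightarrow> M p q).
      measure (case s of (p, q) \<Rightarrow> M p q) N \<le> \<epsilon> \<and>
      (\<forall>\<omega>\<in>space (case s of (p, q) \<Rightarrow> M p q) - N.
        \<bar>(case s of (p, q) \<Rightarrow> lead p q) \<omega>\<bar> \<le> C * \<bar>case s of (p, q) \<Rightarrow> r' p q\<bar>)"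
    (is "\<exists>C>0. \<forall>\<^sub>F s in _. ?good_lead C s") if "\<epsilon> > 0" for \<epsilon>
  proof -
    obtain C where "C > 0" and C: "\<forall>\<^sub>F s in pq_infty. ?good \<epsilon> C s"
      using key[OF \<open>\<epsilon> > 0\<close>] by blast
    from C have "\<forall>\<^sub>F s in pq_infty. ?good_lead C s" by (rule eventually_mono) blast
    with \<open>C > 0\<close> show ?thesis by blast
  qed
  have good_R: "\<exists>C>0. \<forall>\<^sub>F s in pq_infty. \<exists>N\<in>sets (case s of (p, q) \<Rightarrow> M p q).
      measure (case s of (p, q) \<Rightarrow> M p q) N \<le> \<epsilon> \<and>
      (\<forall>\<omega>\<in>space (case s of (p, q) \<Rightarrow> M p q) - N.
        \<bar>(case s of (p, q) \<Rightarrow> R p q) \<omega>\<bar> \<le> C * \<bar>case s of (p, q) \<Rightarrow> r p q\<bar>)"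
    (is "\<exists>C>0. \<forall>\<^sub>F s in _. ?good_R C s") if "\<epsilon> > 0" for \<epsilon>
  proof -
    obtain C where "C > 0" and C: "\<forall>\<^sub>F s in pq_infty. ?good \<epsilon> C s"
      using key[OF \<open>\<epsilon> > 0\<close>] by blast
    from C have "\<forall>\<^sub>F s in pq_infty. ?good_R C s" by (rule eventually_mono) blast
    with \<open>C > 0\<close> show ?thesis by blast
  qed
  have M': "prob_space (case s of (p, q) \<Rightarrow> M p q)" for s
    using M by (cases s) simp

  have "(\<lambda>(p, q). r p q) = (\<lambda>s. (case s of (p, q) \<Rightarrow> \<tau>XY p q * (a p)\<^sup>2 * b q)
      + (case s of (p, q) \<Rightarrow> \<tau>XY p q * a p * (b q)\<^sup>2))"
    by (auto simp: r_def)
  also have "\<dots> \<in> o[pq_infty](\<lambda>_. 1)"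
    by (rule sum_in_smallo) fact+
  finally have r1: "(\<lambda>(p, q). r p q) \<in> o[pq_infty](\<lambda>_. 1)" .
  \<comment> \<open>The rates factor as \<open>r = r' * (a p + b q)\<close>, and the second factor
    tends to 0. Hence \<open>r\<close> is of smaller order than the rate \<open>r'\<close> of the
    leading term.\<close>
  have "((\<lambda>s. a (fst s) + b (snd s)) \<longlongrightarrow> 0 + 0) pq_infty"
    using a0 b0
    by (intro tendsto_add filterlim_compose[OF _ filterlim_fst] filterlim_compose[OF _ filterlim_snd])
  then have "(\<lambda>s. a (fst s) + b (snd s)) \<in> o[pq_infty](\<lambda>_. 1)"
    by (intro smalloI_tendsto) auto
  then have "(\<lambda>s. (case s of (p, q) \<Rightarrow> r' p q) * (a (fst s) + b (snd s)))
      \<in> o[pq_infty](\<lambda>s. (case s of (p, q) \<Rightarrow> r' p q) * 1)"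
    by (rule landau_o.small.mult_left)
  also have "(\<lambda>s. (case s of (p, q) \<Rightarrow> r' p q) * (a (fst s) + b (snd s))) = (\<lambda>(p, q). r p q)"
    by (auto simp: r_def r'_def power2_eq_square algebra_simps)
  finally have rr': "(\<lambda>(p, q). r p q) \<in> o[pq_infty](\<lambda>(p, q). r' p q)" by simp

  show ?thesis
  proof (rule exI[of _ lead], rule exI[of _ R], intro conjI allI ballI)
    show "bigO_prob pq_infty (\<lambda>(p, q). M p q) (\<lambda>(p, q). R p q)
       (\<lambda>(p, q). \<tau>XY p q * (a p)\<^sup>2 * b q + \<tau>XY p q * a p * (b q)\<^sup>2)"
      by (rule bigO_prob_exceptional[OF M' good_R, unfolded r_def])
    show "smallo_prob pq_infty (\<lambda>(p, q). M p q) (\<lambda>(p, q). R p q) (\<lambda>_. 1)"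
      by (rule smallo_prob_exceptional[OF M' good_R r1])
    show "bigO_prob pq_infty (\<lambda>(p, q). M p q) (\<lambda>(p, q). lead p q) (\<lambda>(p, q). \<tau>XY p q * a p * b q)"
      by (rule bigO_prob_exceptional[OF M' good_lead, unfolded r'_def])
    show "smallo_prob pq_infty (\<lambda>(p, q). M p q) (\<lambda>(p, q). R p q) (\<lambda>(p, q). \<tau>XY p q * a p * b q)"
      by (rule smallo_prob_exceptional[OF M' good_R rr', unfolded r'_def])
  qed (simp_all add: lead_def R_def)
qed

end
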